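(* There does not exist a chain $F$ in $\mathcal{NCP}_7$ such that both $F$ and its dual $F^*=\{P^*\mid P\in F\}$ satisfy conditions I, II, III and IV (conditions on a chain, defined in the context, taken with $n=7$).
   Context: Fix $n$ (here $n=7$). All arithmetic on $\{1,\dots,n\}$ is modulo $n$ (elements are placed in cyclic order, e.g. identified with the $n$-th roots of unity). Partitions. Partitions of $\{1,\dots,n\}$ are ordered by refinement: $P\le Q$ if every member of $P$ is contained in some member of $Q$. A *block* of $P$ is a member with more than one element. A block is *consecutive* if it consists of consecutive integers modulo $n$. Two blocks $\sigma,\tau$ are *crossing* if $\sigma\cap\tau=\emptyset$ and there are $\sigma_1,\sigma_2\in\sigma$, $\tau_1,\tau_2\in\tau$ with $\sigma_1<\tau_1<\sigma_2<\tau_2$ or $\tau_1<\sigma_1<\tau_2<\sigma_2$. A partition is non-crossing if no two of its blocks are crossing. $\mathcal{NCP}_n$ is the poset of all non-crossing partitions of $\{1,\dots,n\}$ other than the maximum $\{\{1,\dots,n\}\}$ and the minimum $\{\{1\},\dots,\{n\}\}$. For $P,Q\in\mathcal{NCP}_n$, write $P\nparallel Q$ if some block of $P$ and some block of $Q$ are crossing. Rank. $\operatorname{rk}P=n-|P|$ (where $|P|$ is the number of members of $P$, singletons included). For a chain $F=\{P_1,\dots,P_k\}$ in $\mathcal{NCP}_n$: $\operatorname{rk}F=\{\operatorname{rk}P_1,\dots,\operatorname{rk}P_k\}$ and $\operatorname{cork}F=\{1,\dots,n-2\}\setminus\operatorname{rk}F$. Dual. For $P\in\mathcal{NCP}_n$,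 the dual $P^*\in\mathcal{NCP}_n$ is the partition whose blocks are all sets $\{i_1,\dots,i_k\}$ ($k\ge2$, listed in increasing cyclic order modulo $n$) such that there are distinct members $\sigma_1,\dots,\sigma_k\in P$ with $i_1\in\sigma_1,\dots,i_k\in\sigma_k$ and $i_1+1\in\sigma_2,\ i_2+1\in\sigma_3,\dots,i_{k-1}+1\in\sigma_k,\ i_k+1\in\sigma_1$. The map $P\mapsto P^*$ is an order-reversing bijection of $\mathcal{NCP}_n$. Sets $F_i$, $F_i'$. For a chain $F$ in $\mathcal{NCP}_n$ and $1\le i\le n$, $F_i$ is the smallest subset of $\{1,\dots,n\}$ containing $i$ that appears as a block of a partition in $F$, or $F_i=\{1,\dots,n\}$ if $\{i\}$ is a member of all partitions in $F$. Set $F_i'=F_i\cap\{i-1,i+1\}$. Conditions on a chain $F$ in $\mathcal{NCP}_n$: I. $\operatorname{cork}F$ contains two consecutive integers. II. There is $P\in F$ that is not of the following form: $P$ has exactly one block and that block is consecutive. III. Writing $F=\{P_1<P_2<\dots<P_k\}$, there are $P^+,P^-\in\mathcal{NCP}_n$ such that (i) either $P_i<P^+<P_{i+1}$ and $P_i<P^-<P_{i+1}$ for some $1\le i\le k-1$, or $P^+<P_1$ and $P^-<P_1$, or $P_k<P^+$ and $P_k<P^-$; and (ii) $P^+\nparallel P^-$. IV. There is a maximal chain $C$ in $\mathcal{NCP}_n$ such that $F_i'\cap C_i'=\emptyset$ for all $1\le i\le n$. *)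

theory Defs
  imports "HOL-Library.Disjoint_Sets"
begin

(* The ground set is {1..n} with its usual order; the cyclic structure enters only through
   the following two functions, which stand for i + 1 and i - 1 modulo n. *)
definition cnext :: "nat \<Rightarrow> nat \<Rightarrow> nat" where
  "cnext n i = (if i = n then 1 else i + 1)"

definition cprev :: "nat \<Rightarrow> nat \<Rightarrow> nat" where
  "cprev n i = (if i = 1 then n else i - 1)"

definition blocks :: "nat set set \<Rightarrow> nat set set" where
  "blocks P = {\<sigma> \<in> P. card \<sigma> > 1}"

(* The cyclic arc a, a + 1, ..., a + k modulo n, so that {n, 1} is consecutive. *)
definition consecutive :: "nat \<Rightarrow> nat set \<Rightarrow> bool" where
  "consecutive n \<sigma> \<longleftrightarrow> (\<exists>a\<in>{1..n}. \<exists>k. \<sigma> = (\<lambda>j. (cnext n ^^ j) a) ` {..k})"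

definition crossing :: "nat set \<Rightarrow> nat set \<Rightarrow> bool" where
  "crossing \<sigma> \<tau> \<longleftrightarrow> \<sigma> \<inter> \<tau> = {} \<and>
     (\<exists>s1\<in>\<sigma>. \<exists>s2\<in>\<sigma>. \<exists>t1\<in>\<tau>. \<exists>t2\<in>\<tau>.
        (s1 < t1 \<and> t1 < s2 \<and> s2 < t2) \<or> (t1 < s1 \<and> s1 < t2 \<and> t2 < s2))"

definition noncrossing :: "nat set set \<Rightarrow> bool" where
  "noncrossing P \<longleftrightarrow> (\<forall>\<sigma>\<in>blocks P. \<forall>\<tau>\<in>blocks P. \<not> crossing \<sigma> \<tau>)"

definition NCP :: "nat \<Rightarrow> nat set set set" where
  "NCP n = {P. partition_on {1..n} P \<and> noncrossing P} - {{{1..n}}, (\<lambda>i. {i}) ` {1..n}}"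

definition cross_partitions :: "nat set set \<Rightarrow> nat set set \<Rightarrow> bool" where
  "cross_partitions P Q \<longleftrightarrow> (\<exists>\<sigma>\<in>blocks P. \<exists>\<tau>\<in>blocks Q. crossing \<sigma> \<tau>)"

definition strictly_refines :: "nat \<Rightarrow> nat set set \<Rightarrow> nat set set \<Rightarrow> bool" where
  "strictly_refines n P Q \<longleftrightarrow> refines {1..n} P Q \<and> P \<noteq> Q"

(* pred_on.chain takes a relation and uses its reflexive closure, hence the strict order. *)
definition NCP_chain :: "nat \<Rightarrow> nat set set set \<Rightarrow> bool" where
  "NCP_chain n F \<longleftrightarrow> pred_on.chain (NCP n) (strictly_refines n) F"

definition NCP_maxchain :: "nat \<Rightarrow> nat set set set \<Rightarrow> bool" where
  "NCP_maxchain n C \<longleftrightarrow> pred_on.maxchain (NCP n) (strictly_refines n) C"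

(* The truncated subtraction is harmless: a partition of {1..n} has at most n members. *)
definition rk :: "nat \<Rightarrow> nat set set \<Rightarrow> nat" where
  "rk n P = n - card P"

definition cork :: "nat \<Rightarrow> nat set set set \<Rightarrow> nat set" where
  "cork n F = {1..n - 2} - rk n ` F"

(* A list is in increasing cyclic order if some rotation of it is strictly increasing.
   With 0-based positions, xs ! j = i_(j+1) and ss ! j = sigma_(j+1). *)
definition dual_blocks :: "nat \<Rightarrow> nat set set \<Rightarrow> nat set set" where
  "dual_blocks n P = {set xs | xs. length xs \<ge> 2 \<and> set xs \<subseteq> {1..n} \<and>
     (\<exists>m. sorted_wrt (<) (rotate m xs)) \<and>
     (\<exists>ss. length ss = length xs \<and> distinct ss \<and> set ss \<subseteq> P \<and>
        (\<forall>j<length xs. xs ! j \<in> ss ! j \<and>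
           cnext n (xs ! j) \<in> ss ! (Suc j mod length xs)))}"

definition dual :: "nat \<Rightarrow> nat set set \<Rightarrow> nat set set" where
  "dual n P = dual_blocks n P \<union> (\<lambda>i. {i}) ` ({1..n} - \<Union>(dual_blocks n P))"

(* LEAST is with respect to inclusion; it exists for a chain F, since the blocks of members
   of F that contain i are then nested. *)
definition min_block :: "nat \<Rightarrow> nat set set set \<Rightarrow> nat \<Rightarrow> nat set" where
  "min_block n F i =
     (if \<forall>P\<in>F. {i} \<in> P then {1..n} else (LEAST \<sigma>. i \<in> \<sigma> \<and> (\<exists>P\<in>F. \<sigma> \<in> blocks P)))"

definition min_block_nbrs :: "nat \<Rightarrow> nat set set set \<Rightarrow> nat \<Rightarrow> nat set" where
  "min_block_nbrs n F i = min_block n F i \<inter> {cprev n i, cnext n i}"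

definition cond_I :: "nat \<Rightarrow> nat set set set \<Rightarrow> bool" where
  "cond_I n F \<longleftrightarrow> (\<exists>j. j \<in> cork n F \<and> j + 1 \<in> cork n F)"

definition cond_II :: "nat \<Rightarrow> nat set set set \<Rightarrow> bool" where
  "cond_II n F \<longleftrightarrow> (\<exists>P\<in>F. \<not> (\<exists>\<sigma>. blocks P = {\<sigma>} \<and> consecutive n \<sigma>))"

(* The list Ps enumerates F in increasing order; F is nonempty because P_1 and P_k are
   referred to. *)
definition cond_III :: "nat \<Rightarrow> nat set set set \<Rightarrow> bool" where
  "cond_III n F \<longleftrightarrow>
     (\<exists>Ps. Ps \<noteq> [] \<and> set Ps = F \<and> sorted_wrt (strictly_refines n) Ps \<and>
        (\<exists>Pp\<in>NCP n. \<exists>Pm\<in>NCP n.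
           ((\<exists>i. Suc i < length Ps \<and>
               strictly_refines n (Ps ! i) Pp \<and> strictly_refines n Pp (Ps ! Suc i) \<and>
               strictly_refines n (Ps ! i) Pm \<and> strictly_refines n Pm (Ps ! Suc i)) \<or>
            (strictly_refines n Pp (hd Ps) \<and> strictly_refines n Pm (hd Ps)) \<or>
            (strictly_refines n (last Ps) Pp \<and> strictly_refines n (last Ps) Pm)) \<and>
           cross_partitions Pp Pm))"

definition cond_IV :: "nat \<Rightarrow> nat set set set \<Rightarrow> bool" where
  "cond_IV n F \<longleftrightarrow>
     (\<exists>C. NCP_maxchain n C \<and> (\<forall>i\<in>{1..n}. min_block_nbrs n F i \<inter> min_block_nbrs n C i = {}))"

end

(* Call a flag (i, j), with j = i + 1 or j = i - 1 modulo n, covered by a chain if j lies in the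
   smallest block of the chain containing i. Then IV says that F and C cover no common flag; for
   n = 7 this is incompatible with III.

   Every chain refines to a walk from the minimum to the maximum that joins two blocks at a time;
   joining a singleton {i} to a block containing j covers (i, j), and a chain covers at least the
   flags of any walk refining it. If F satisfies III, then F also refines to such a walk in which
   one step joins four blocks at once, no one of them separating two others: P+ and P- provide
   crossing pairs of blocks inside one gap of F, and nothing of F lies in between. For n = 7 the
   second kind of walk has one 4-step and three 2-steps and the first kind six 2-steps.

   An exhaustive search shows that the flags of each walk of the second kind contain, up to rotation
   and reflection, one of fourteen sets, and that every walk of the first kind covers a flag
   of each of these sets. Hence F and C always cover a common flag. *)

theory Submission
  imports Defs "HOL-Library.Multiset"
begin

subsection \<open>Noncrossing equivalence relations\<close>

text \<open>\<open>P+\<close> and \<open>P-\<close> of condition III are incomparable, so no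
  refinement of F to a chain passes through both. The 4-step records what survives of this freedom:
  a singleton taking part in it gains a flag for every neighbour in any of the four joined blocks,
  whereas three successive 2-steps joining the same blocks may lose some of these flags. This
  surplus is what makes a common flag unavoidable.

  A walk covers only part of the flags of its chain. On both sides this is harmless, because a flag
  common to the walks is common to the chains.

  Comparing every walk of one kind with every walk of the other would be a search over pairs. The
  fourteen sets decouple it: being hit by all walks of 2-steps is inherited by supersets and
  invariant under rotation and reflection, so it is evaluated once per set, and the walks with a
  4-step are compared with the sets alone.

  Partitions are handled as equivalence relations, where refinement is the pointwise order and
  joining blocks is a formula.\<close>

definition nceq :: "nat \<Rightarrow> (nat \<Rightarrow> nat \<Rightarrow> bool) \<Rightarrow> bool" where
  "nceq n r \<longleftrightarrow> (\<forall>i j. r i j \<longrightarrow> i \<in> {1..n} \<and> j \<in> {1..n}) \<and> (\<forall>i\<in>{1..n}. r i i) \<and>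
     (\<forall>i j. r i j \<longrightarrow> r j i) \<and> (\<forall>i j k. r i j \<longrightarrow> r j k \<longrightarrow> r i k) \<and>
     (\<forall>a b c d. a < b \<longrightarrow> b < c \<longrightarrow> c < d \<longrightarrow> r a c \<longrightarrow> r b d \<longrightarrow> r a b)"

lemma nceq_dom: "nceq n r \<Longrightarrow> r i j \<Longrightarrow> i \<in> {1..n} \<and> j \<in> {1..n}"
  unfolding nceq_def by metis

lemma nceq_refl: "nceq n r \<Longrightarrow> i \<in> {1..n} \<Longrightarrow> r i i"
  unfolding nceq_def by metis

lemma nceq_sym: "nceq n r \<Longrightarrow> r i j \<Longrightarrow> r j i"
  unfolding nceq_def by metis

lemma nceq_trans: "nceq n r \<Longrightarrow> r i j \<Longrightarrow> r j k \<Longrightarrow> r i k"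
  unfolding nceq_def by metis

lemma nceq_noncrossing:
  "nceq n r \<Longrightarrow> a < b \<Longrightarrow> b < c \<Longrightarrow> c < d \<Longrightarrow> r a c \<Longrightarrow> r b d \<Longrightarrow> r a b"
  unfolding nceq_def by metis

definition eqbot :: "nat \<Rightarrow> nat \<Rightarrow> nat \<Rightarrow> bool" where
  "eqbot n i j \<longleftrightarrow> i = j \<and> i \<in> {1..n}"

definition eqtop :: "nat \<Rightarrow> nat \<Rightarrow> nat \<Rightarrow> bool" where
  "eqtop n i j \<longleftrightarrow> i \<in> {1..n} \<and> j \<in> {1..n}"

lemma nceq_eqbot: "nceq n (eqbot n)"
  unfolding nceq_def eqbot_def by auto

lemma nceq_eqtop: "nceq n (eqtop n)"
  unfolding nceq_def eqtop_def by auto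

lemma eqbot_le: "nceq n r \<Longrightarrow> eqbot n \<le> r"
  using nceq_refl[of n r] by (auto simp: eqbot_def le_fun_def)

lemma le_eqtop: "nceq n r \<Longrightarrow> r \<le> eqtop n"
  using nceq_dom[of n r] by (auto simp: eqtop_def le_fun_def)

text \<open>A point under the chord \<open>t u\<close> cannot be related to one beyond its ends
  without a crossing, and relation to an end itself would put it into the class of the
  chord.\<close>

lemma nceq_inside:
  assumes "nceq n r" "r t u" "t < p" "p < u" "\<not> r t p" "r p x"
  shows "t < x \<and> x < u"
proof -
  have "x \<noteq> t" "x \<noteq> u"
    using assms nceq_sym nceq_trans by metis+
  moreover have "\<not> x < t"
    using assms nceq_noncrossing[of n r x t p u] nceq_sym nceq_trans by metis
  moreover have "\<not> u < x"
    using assms nceq_noncrossing[of n r t p u x] by metis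
  ultimately show ?thesis
    by auto
qed

section \<open>Joining classes without creating crossings\<close>

definition merge :: "nat set \<Rightarrow> (nat \<Rightarrow> nat \<Rightarrow> bool) \<Rightarrow> nat \<Rightarrow> nat \<Rightarrow> bool" where
  "merge X r i j \<longleftrightarrow> r i j \<or> (\<exists>x\<in>X. r i x) \<and> (\<exists>y\<in>X. r j y)"

lemma le_merge: "r \<le> merge X r"
  by (auto simp: merge_def le_fun_def)

lemma merge_le:
  assumes "nceq n s" "r \<le> s" "\<And>x y. x \<in> X \<Longrightarrow> y \<in> X \<Longrightarrow> s x y"
  shows "merge X r \<le> s"
proof (intro predicate2I)
  fix i j
  assume "merge X r i j"
  then show "s i j"
    unfolding merge_def using assms nceq_sym[OF assms(1)] nceq_trans[OF assms(1)]
    by (meson predicate2D)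
qed

lemma nceq_merge:
  assumes r: "nceq n r"
    and nc: "\<And>a b c d. a < b \<Longrightarrow> b < c \<Longrightarrow> c < d \<Longrightarrow> merge X r a c \<Longrightarrow> merge X r b d \<Longrightarrow> merge X r a b"
  shows "nceq n (merge X r)"
  unfolding nceq_def
proof (intro conjI allI impI ballI)
  fix i j k
  assume "merge X r i j" "merge X r j k"
  then show "merge X r i k"
    unfolding merge_def using nceq_trans[OF r] nceq_sym[OF r] by meson
qed (use r nc in \<open>auto simp: merge_def dest: nceq_dom nceq_refl nceq_sym\<close>)

text \<open>
  A pair of \<open>s\<close>-related points on either side of \<open>U\<close> at minimal distance has no point of its
  \<open>s\<close>-class strictly in between, so joining their classes creates no crossing.
\<close>

lemma exists_merge:
  assumes r: "nceq n r" and s: "nceq n s" and le: "r \<le> s"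
    and U: "\<And>z w. z \<in> U \<Longrightarrow> r z w \<Longrightarrow> w \<in> U" and e: "x0 \<in> U" "y0 \<notin> U" "s x0 y0"
  obtains x y where "x \<in> U" "y \<notin> U" "s x y" "\<not> r x y" "nceq n (merge {x, y} r)" "merge {x, y} r \<le> s"
proof -
  define A where "A = (\<lambda>(x, y). x \<in> U \<and> y \<notin> U \<and> s x y)"
  define d :: "nat \<times> nat \<Rightarrow> nat" where "d = (\<lambda>(x, y). (x - y) + (y - x))"
  have "A (x0, y0)"
    using e by (auto simp: A_def)
  then obtain m where m: "A m" "\<And>z. A z \<Longrightarrow> d m \<le> d z"
    using ex_has_least_nat[of A "(x0, y0)" d] by blast
  obtain x y where xy: "m = (x, y)"
    by (cases m)
  have A: "x \<in> U" "y \<notin> U" "s x y" "\<not> r x y"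
    using m(1) U by (auto simp: A_def xy)
  \<comment> \<open>A related point strictly in between could replace \<open>x\<close> if it lies in
    \<open>U\<close> and \<open>y\<close> otherwise, giving a closer pair.\<close>
  have far: "\<not> (x < z \<and> z < y)" "\<not> (y < z \<and> z < x)" if "s x z" for z
  proof -
    have "s z y"
      using nceq_trans[OF s nceq_sym[OF s that] A(3)] .
    then have "A (z, y) \<or> A (x, z)"
      using that A by (auto simp: A_def)
    then show "\<not> (x < z \<and> z < y)" "\<not> (y < z \<and> z < x)"
      using m(2)[of "(z, y)"] m(2)[of "(x, z)"] by (auto simp: d_def xy)
  qed
  \<comment> \<open>The chord \<open>t u\<close> encloses the class of \<open>p\<close> but not that
    of \<open>q\<close>, so one of \<open>x\<close>, \<open>y\<close> is under it and the other
    beyond it. Then \<open>t\<close> or \<open>u\<close> lies strictly between them, which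
    \<open>far\<close> excludes.\<close>
  have split: False
    if t: "r t u" "t < p" "p < u" "q < t \<or> u < q" and pq: "s x t" "\<not> r t p" "\<not> r t q"
      and c: "r p x \<and> r q y \<or> r p y \<and> r q x" for t u p q
  proof -
    have su: "s x u"
      using t(1) pq(1) le nceq_trans[OF s] by blast
    have out: "z < t \<or> u < z" if "r q z" for z
    proof (rule ccontr)
      assume "\<not> ?thesis"
      moreover have "\<not> r t z" "r z q"
        using that pq(3) nceq_trans[OF r] nceq_sym[OF r] by blast+
      moreover have "z \<noteq> t" "z \<noteq> u"
        using calculation(2) t(1) nceq_refl[OF r] nceq_dom[OF r t(1)] by auto
      ultimately have "t < q \<and> q < u"
        using nceq_inside[OF r t(1), of z q] by auto
      then show False
        using t(4) by auto
    qed
    have ins: "t < z \<and> z < u" if "r p z" for z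
      using nceq_inside[OF r t(1-3) pq(2) that] .
    show False
      using c out ins far[OF pq(1)] far[OF su] by (meson less_trans)
  qed
  have nc: "merge {x, y} r a b"
    if abcd: "a < b" "b < c" "c < d" and ac: "merge {x, y} r a c" and bd: "merge {x, y} r b d"
    for a b c d
  proof (rule ccontr)
    assume no: "\<not> ?thesis"
    have nab: "\<not> r a b"
      using no by (auto simp: merge_def)
    have M: "merge {x, y} r \<le> s"
      by (rule merge_le[OF s le]) (use A(3) nceq_sym[OF s] nceq_refl[OF s] nceq_dom[OF s A(3)] in auto)
    have sab: "s a b"
      using nceq_noncrossing[OF s abcd] ac bd M by blast
    consider "r a c" "r b d" | "r a c" "\<not> r b d" | "\<not> r a c" "r b d" | "\<not> r a c" "\<not> r b d"
      by blast
    then show False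
    proof cases
      case 1
      then show False
        using nceq_noncrossing[OF r abcd] nab by blast
    next
      case 2
      then have "(r b x \<or> r b y) \<and> (r d x \<or> r d y)"
        using bd by (auto simp: merge_def)
      then have c: "r b x \<and> r d y \<or> r b y \<and> r d x"
        using 2(2) nceq_trans[OF r] nceq_sym[OF r] by metis
      then have "s b x"
        using le A(3) nceq_trans[OF s] nceq_sym[OF s] by (metis predicate2D)
      then have "s x a"
        using sab nceq_trans[OF s] nceq_sym[OF s] by metis
      moreover have "\<not> r a d"
      proof
        assume "r a d"
        then have "r a x \<or> r a y"
          using c nceq_trans[OF r] by metis
        then show False
          using no c by (auto simp: merge_def)
      qed
      ultimately show False
        using split[of a c b d] 2 abcd c nab by blast
    next
      case 3
      then have "(r a x \<or> r a y) \<and> (r c x \<or> r c y)"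
        using ac by (auto simp: merge_def)
      then have c: "r a x \<and> r c y \<or> r a y \<and> r c x"
        using 3(1) nceq_trans[OF r] nceq_sym[OF r] by metis
      then have "s a x"
        using le A(3) nceq_trans[OF s] nceq_sym[OF s] by (metis predicate2D)
      then have "s x b"
        using sab nceq_trans[OF s] nceq_sym[OF s] by metis
      moreover have "\<not> r b c" "\<not> r b a"
      proof -
        show "\<not> r b a"
          using nab nceq_sym[OF r] by metis
        show "\<not> r b c"
        proof
          assume "r b c"
          then have "r b x \<or> r b y"
            using c nceq_trans[OF r] by metis
          then show False
            using no c by (auto simp: merge_def)
        qed
      qed
      ultimately show False
        using split[of b d c a] 3 abcd c by blast
    next
      case 4
      then show False
        using ac bd no by (auto simp: merge_def)
    qed
  qed
  show thesis
  proof (rule that[OF A nceq_merge[OF r nc]])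
    show "merge {x, y} r \<le> s"
      by (rule merge_le[OF s le]) (use A(3) nceq_sym[OF s] nceq_refl[OF s] nceq_dom[OF s A(3)] in auto)
  qed
qed

subsection \<open>Walks and the flags they cover\<close>

definition flags :: "nat \<Rightarrow> (nat \<Rightarrow> nat \<Rightarrow> bool) \<Rightarrow> (nat \<Rightarrow> nat \<Rightarrow> bool) \<Rightarrow> (nat \<times> nat) set" where
  "flags n r s = {(i, j). (j = cprev n i \<or> j = cnext n i) \<and> (\<forall>k. r i k \<longrightarrow> k = i) \<and> s i j}"

text \<open>
  For a chain, \<open>(i, j)\<close> is covered iff \<open>j\<close> is a neighbour of \<open>i\<close> in the smallest block containing \<open>i\<close>.
\<close>

definition covered :: "nat \<Rightarrow> (nat \<Rightarrow> nat \<Rightarrow> bool) set \<Rightarrow> (nat \<times> nat) set" where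
  "covered n F = {(i, j). i \<in> {1..n} \<and> j \<in> {1..n} \<and> (j = cprev n i \<or> j = cnext n i) \<and>
     (\<forall>r\<in>F. (\<forall>k. r i k \<longrightarrow> k = i) \<or> r i j)}"

text \<open>A relation below \<open>r\<close> still has \<open>i\<close> as a singleton, and one
  above \<open>s\<close> already relates \<open>i\<close> to \<open>j\<close>.\<close>

lemma flags_covered:
  assumes "nceq n s" "\<And>R. R \<in> F \<Longrightarrow> R \<le> r \<or> s \<le> R"
  shows "flags n r s \<subseteq> covered n F"
  using assms nceq_dom[OF assms(1)] unfolding flags_def covered_def le_fun_def le_bool_def by blast

text \<open>One of the two sides of the chord \<open>x y\<close>. Only comparisons of the values at
  two points matter below: they tell whether the chord separates them, wherever the circle is cut
  open.\<close>

definition between :: "nat \<Rightarrow> nat \<Rightarrow> nat \<Rightarrow> bool" where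
  "between x y t = (if x < t then t < y else if t < x then y < t else False)"

lemma between_iff: "between x y t \<longleftrightarrow> x < t \<and> t < y \<or> y < t \<and> t < x"
  by (auto simp: between_def)

text \<open>If the sides differed, one point would lie under the chord and the other beyond an end,
  which is the forbidden pattern up to exchanging \<open>x\<close> and \<open>y\<close>. In this
  form the linear order of the four points disappears.\<close>

lemma same_side:
  assumes r: "nceq n r" and xy: "r x y" and tu: "r t u" and no: "\<not> r x t"
  shows "between x y t \<longleftrightarrow> between x y u"
proof -
  have main: False if "r x y" "r t u" "x < t" "t < y" "u < x \<or> y < u" "\<not> r x t" for x y t u
    using that nceq_noncrossing[OF r, of x t y u] nceq_noncrossing[OF r, of u x t y]
      nceq_sym[OF r] nceq_trans[OF r] by metis
  have imp: False if "r x y" "r t u" "\<not> r x t" "between x y t" "\<not> between x y u" for x y t u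
  proof -
    have "u \<noteq> x" "u \<noteq> y" "\<not> r y t"
      using that(1-3) nceq_sym[OF r] nceq_trans[OF r] by metis+
    then show False
      using main[OF that(1,2)] main[OF nceq_sym[OF r that(1)] that(2)] that(3-5)
      unfolding between_iff by linarith
  qed
  have "\<not> r x u"
    using no tu nceq_sym[OF r] nceq_trans[OF r] by metis
  then show ?thesis
    using imp[OF xy tu no] imp[OF xy nceq_sym[OF r tu]] by blast
qed

text \<open>By \<open>between_swap\<close> the equation says, for points of distinct classes, that a
  chord \<open>t u\<close> of the class of \<open>x\<close> does not separate \<open>v\<close> from
  \<open>w\<close>. The condition is void for two classes, so among the steps considered it
  restricts only the 4-steps, whose search it prunes.\<close>

definition unseparated :: "(nat \<Rightarrow> nat \<Rightarrow> bool) \<Rightarrow> nat set \<Rightarrow> bool" where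
  "unseparated r X \<longleftrightarrow> (\<forall>x\<in>X. \<forall>y\<in>X. \<forall>z\<in>X. x \<noteq> y \<longrightarrow> x \<noteq> z \<longrightarrow> y \<noteq> z \<longrightarrow>
     (\<forall>t u v w. r x t \<longrightarrow> r x u \<longrightarrow> r y v \<longrightarrow> r z w \<longrightarrow> between v w t = between v w u))"

lemma unseparated_pair: "card X = 2 \<Longrightarrow> unseparated r X"
  unfolding unseparated_def by (auto simp: card_2_iff)

text \<open>The list records the size of each step, so that the shapes of walks can be enumerated; a
  step of size \<open>k\<close> lowers the number of classes by \<open>k - 1\<close>.\<close>

inductive walk :: "nat \<Rightarrow> nat list \<Rightarrow> (nat \<Rightarrow> nat \<Rightarrow> bool) \<Rightarrow> (nat \<times> nat) set \<Rightarrow> bool" for n where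
  walk_top: "walk n [] (eqtop n) {}"
| walk_merge: "nceq n r \<Longrightarrow> X \<subseteq> {1..n} \<Longrightarrow> card X = k \<Longrightarrow> k > 0 \<Longrightarrow>
    (\<And>x y. x \<in> X \<Longrightarrow> y \<in> X \<Longrightarrow> r x y \<Longrightarrow> x = y) \<Longrightarrow> nceq n (merge X r) \<Longrightarrow> unseparated r X \<Longrightarrow>
    walk n ks (merge X r) V \<Longrightarrow> walk n (k # ks) r (flags n r (merge X r) \<union> V)"

section \<open>Refining chains to walks\<close>

abbreviation excess :: "(nat \<Rightarrow> nat \<Rightarrow> bool) \<Rightarrow> (nat \<Rightarrow> nat \<Rightarrow> bool) \<Rightarrow> (nat \<times> nat) set" where
  "excess s r \<equiv> {(i, j). s i j \<and> \<not> r i j}"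

lemma finite_excess: "nceq n s \<Longrightarrow> finite (excess s r)"
  by (rule finite_subset[of _ "{1..n} \<times> {1..n}"]) (auto dest: nceq_dom)

lemma card_excess_merge:
  assumes "nceq n s" "r \<le> s" "s x y" "\<not> r x y" "r x x" "r y y"
  shows "card (excess s (merge {x, y} r)) < card (excess s r)"
proof (rule psubset_card_mono[OF finite_excess[OF assms(1)]])
  have "(x, y) \<in> excess s r - excess s (merge {x, y} r)"
    using assms by (auto simp: merge_def)
  then show "excess s (merge {x, y} r) \<subset> excess s r"
    by (auto simp: merge_def)
qed

lemma walk_pair:
  assumes "nceq n r" "nceq n (merge {x, y} r)" "\<not> r x y" "r x x" "r y y" "walk n ks (merge {x, y} r) V"
  shows "walk n (2 # ks) r (flags n r (merge {x, y} r) \<union> V)"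
proof (rule walk_merge[OF assms(1) _ _ _ _ assms(2) _ assms(6)])
  show "{x, y} \<subseteq> {1..n}"
    using nceq_dom[OF assms(1)] assms(4,5) by blast
  show card: "card {x, y} = 2"
    using assms(3,4) by (cases "x = y") auto
  show "\<And>u v. u \<in> {x, y} \<Longrightarrow> v \<in> {x, y} \<Longrightarrow> r u v \<Longrightarrow> u = v"
    using assms(3) nceq_sym[OF assms(1)] by auto
  show "unseparated r {x, y}"
    using unseparated_pair[OF card] .
qed simp

text \<open>While \<open>r\<close> and \<open>s\<close> differ, some class of \<open>r\<close> is
  linked by \<open>s\<close> to a point outside it, and \<open>exists_merge\<close> yields a 2-step
  staying below \<open>s\<close>. Every member of \<open>F\<close> remains on one side of this step,
  so its flags are covered; the number of missing pairs decreases.\<close>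

lemma walk_refine:
  assumes "nceq n s" "walk n ks s V"
  shows "nceq n r \<Longrightarrow> r \<le> s \<Longrightarrow> (\<And>R. R \<in> F \<Longrightarrow> R \<le> r \<or> s \<le> R) \<Longrightarrow>
    \<exists>m V'. walk n (replicate m 2 @ ks) r V' \<and> V' \<subseteq> covered n F \<union> V"
proof (induction "card (excess s r)" arbitrary: r rule: less_induct)
  case less
  show ?case
  proof (cases "r = s")
    case True
    then show ?thesis
      using assms(2) by (intro exI[of _ 0] exI[of _ V]) auto
  next
    case False
    then obtain e y0 where e: "s e y0" "\<not> r e y0"
      using less.prems(2) by (metis antisym predicate2I)
    have "w \<in> {z. r e z}" if "z \<in> {z. r e z}" "r z w" for z w
      using that nceq_trans[OF less.prems(1)] by blast
    moreover have "e \<in> {z. r e z}" "y0 \<notin> {z. r e z}"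
      using e nceq_refl[OF less.prems(1)] nceq_dom[OF assms(1) e(1)] by auto
    ultimately obtain x y where xy: "s x y" "\<not> r x y" "nceq n (merge {x, y} r)" "merge {x, y} r \<le> s"
      using exists_merge[OF less.prems(1) assms(1) less.prems(2) _ _ _ e(1), of "{z. r e z}"] by metis
    have n: "\<not> r x y" "r x x" "r y y"
      using xy(2) nceq_refl[OF less.prems(1)] nceq_dom[OF assms(1) xy(1)] by blast+
    have F: "R \<le> merge {x, y} r \<or> s \<le> R" "R \<le> r \<or> merge {x, y} r \<le> R" if "R \<in> F" for R
      using less.prems(3)[OF that] le_merge[of r "{x, y}"] xy(4) by (meson order_trans)+
    obtain m V' where V': "walk n (replicate m 2 @ ks) (merge {x, y} r) V'" "V' \<subseteq> covered n F \<union> V"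
      using less.hyps[OF card_excess_merge[OF assms(1) less.prems(2) xy(1) n] xy(3,4) F(1)] by blast
    show ?thesis
      using walk_pair[OF less.prems(1) xy(3) n V'(1)] V'(2) flags_covered[OF xy(3) F(2)]
      by (intro exI[of _ "Suc m"] exI[of _ "flags n r (merge {x, y} r) \<union> V'"]) auto
  qed
qed

text \<open>The walk grows backwards along \<open>L\<close>, each gap being filled by
  \<open>walk_refine\<close>. Since \<open>L\<close> is sorted, every member of \<open>F\<close> is
  on one side of each gap.\<close>

lemma walk_chain:
  assumes "L \<noteq> []" "nceq n (last L)" "walk n ks (last L) V" "sorted_wrt (\<le>) L"
    "\<And>R. R \<in> set L \<Longrightarrow> nceq n R"
    "\<And>R. R \<in> F \<Longrightarrow> R \<le> hd L \<or> R \<in> set L \<or> last L \<le> R"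
  shows "\<exists>m V'. walk n (replicate m 2 @ ks) (hd L) V' \<and> V' \<subseteq> covered n F \<union> V"
  using assms
proof (induction L rule: list_nonempty_induct)
  case (single r)
  then show ?case
    by (intro exI[of _ 0] exI[of _ V]) auto
next
  case (cons r L)
  have last: "last L \<in> set L"
    using cons.hyps by simp
  have hd: "hd L \<le> R" if "R \<in> set L" for R
    using that cons.prems(3) by (cases L) auto
  have "\<exists>m V1. walk n (replicate m 2 @ ks) (hd L) V1 \<and> V1 \<subseteq> covered n F \<union> V"
  proof (rule cons.IH)
    fix R assume "R \<in> F"
    then have "R \<le> r \<or> R = r \<or> R \<in> set L \<or> last L \<le> R"
      using cons.prems(5)[of R] cons.hyps by auto
    then show "R \<le> hd L \<or> R \<in> set L \<or> last L \<le> R"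
    proof (elim disjE)
      show "R \<le> hd L \<or> R \<in> set L \<or> last L \<le> R" if "R \<le> r"
        using that cons.prems(3) cons.hyps order_trans[of R r "hd L"] by simp
    qed (use cons.prems(3) cons.hyps in simp_all)
  qed (use cons.prems(1-4) cons.hyps in simp_all)
  then obtain m V1 where V1: "walk n (replicate m 2 @ ks) (hd L) V1" "V1 \<subseteq> covered n F \<union> V"
    by blast
  have "\<exists>m' V'. walk n (replicate m' 2 @ replicate m 2 @ ks) r V' \<and> V' \<subseteq> covered n F \<union> V1"
  proof (rule walk_refine[OF _ V1(1)])
    fix R assume "R \<in> F"
    then have "R \<le> r \<or> R = r \<or> R \<in> set L \<or> last L \<le> R"
      using cons.prems(5)[of R] cons.hyps by auto
    then show "R \<le> r \<or> hd L \<le> R"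
      using hd[of R] order_trans[OF hd[OF last], of R] by auto
  qed (use cons.prems(3,4) cons.hyps in simp_all)
  then obtain m' V' where "walk n (replicate (m' + m) 2 @ ks) r V'" "V' \<subseteq> covered n F \<union> V1"
    by (auto simp: replicate_add)
  then show ?case
    using V1(2) by (intro exI[of _ "m' + m"] exI[of _ V']) auto
qed

text \<open>The jump is made at the bottom of the gap from \<open>p\<close> to \<open>q\<close>, and
  2-steps fill the rest. No member of \<open>F\<close> resolves the jump into smaller steps, so all
  its flags are covered.\<close>

lemma walk_jump:
  assumes q: "nceq n q" "walk n ks q V" and p: "nceq n p" and le: "p \<le> q"
    and X: "X \<subseteq> {1..n}" "card X = k" "k > 0" "\<And>x y. x \<in> X \<Longrightarrow> y \<in> X \<Longrightarrow> p x y \<Longrightarrow> x = y"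
    and M: "nceq n (merge X p)" "merge X p \<le> q" "unseparated p X"
    and F: "\<And>R. R \<in> F \<Longrightarrow> R \<le> p \<or> q \<le> R"
  shows "\<exists>m V'. walk n (k # replicate m 2 @ ks) p V' \<and> V' \<subseteq> covered n F \<union> V"
proof -
  have F': "R \<le> merge X p \<or> q \<le> R" "R \<le> p \<or> merge X p \<le> R" if "R \<in> F" for R
    using F[OF that] le_merge[of p X] M(2) by (meson order_trans)+
  obtain m V' where V': "walk n (replicate m 2 @ ks) (merge X p) V'" "V' \<subseteq> covered n F \<union> V"
    using walk_refine[OF q M(1,2) F'(1)] by blast
  show ?thesis
    using walk_merge[OF p X M(1,3) V'(1)] V'(2) flags_covered[OF M(1) F'(2)]
    by (intro exI[of _ m] exI[of _ "flags n p (merge X p) \<union> V'"]) auto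
qed

section \<open>Crossing chords and the construction of the 4-step\<close>

lemma between_commute: "between x y t \<longleftrightarrow> between y x t"
  by (auto simp: between_iff)

text \<open>Both sides say that the chords \<open>x y\<close> and \<open>t u\<close> do not
  cross.\<close>

lemma between_swap:
  assumes "t \<noteq> x" "t \<noteq> y" "u \<noteq> x" "u \<noteq> y"
  shows "between x y t = between x y u \<longleftrightarrow> between t u x = between t u y"
  using assms unfolding between_iff by linarith

lemma between_less: "t \<noteq> x \<Longrightarrow> t \<noteq> y \<Longrightarrow> between x y t \<longleftrightarrow> (x < t) \<noteq> (y < t)"
  unfolding between_iff by auto

text \<open>Seen from \<open>v\<close>, both \<open>t\<close> and \<open>u\<close> lie beyond the
  chord \<open>w z\<close>, and the whole arc beyond it is on one side of the chord
  \<open>v w\<close>.\<close>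

lemma between_opposite:
  assumes "between t v w \<noteq> between t v z" "between u v w \<noteq> between u v z"
    "t \<notin> {v, w, z}" "u \<notin> {v, w, z}" "v \<notin> {w, z}" "w \<noteq> z"
  shows "between v w t = between v w u"
proof -
  have ne: "t \<noteq> v" "t \<noteq> w" "t \<noteq> z" "u \<noteq> v" "u \<noteq> w" "u \<noteq> z" "v \<noteq> w" "v \<noteq> z" "w \<noteq> z"
    using assms by auto
  note [simp] = ne ne[symmetric]
  have "((t < w) \<noteq> (v < w)) \<noteq> ((t < z) \<noteq> (v < z))" "((u < w) \<noteq> (v < w)) \<noteq> ((u < z) \<noteq> (v < z))"
    using assms(1,2) by (simp_all add: between_less)
  then have "((v < t) \<noteq> (w < t)) = ((v < u) \<noteq> (w < u))"
    using ne by (smt (verit) less_trans linorder_neqE_nat not_less_iff_gr_or_eq)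
  then show ?thesis
    by (simp add: between_less)
qed

text \<open>The chord \<open>j l\<close> has \<open>i\<close> and \<open>k\<close> on different
  sides, with \<open>x\<close> on the side of \<open>i\<close> and \<open>y\<close> on that of
  \<open>k\<close>. So the chords \<open>i x\<close> and \<open>k y\<close> lie on different sides
  of it and cannot cross.\<close>

lemma between_uncrossed:
  assumes "between i k j \<noteq> between i k l" "between i x j = between i x l" "between k y j = between k y l"
    "j \<notin> {i, k, x, y}" "l \<notin> {i, k, x, y}" "i \<notin> {k, x, y}" "k \<notin> {x, y}" "x \<noteq> y"
  shows "between i x k = between i x y"
proof -
  have ne: "j \<noteq> i" "j \<noteq> k" "j \<noteq> x" "j \<noteq> y" "l \<noteq> i" "l \<noteq> k" "l \<noteq> x" "l \<noteq> y"
    "i \<noteq> k" "i \<noteq> x" "i \<noteq> y" "k \<noteq> x" "k \<noteq> y" "x \<noteq> y"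
    using assms by auto
  note [simp] = ne ne[symmetric]
  have "((i < j) \<noteq> (k < j)) \<noteq> ((i < l) \<noteq> (k < l))" "((i < j) \<noteq> (x < j)) = ((i < l) \<noteq> (x < l))"
    "((k < j) \<noteq> (y < j)) = ((k < l) \<noteq> (y < l))"
    using assms(1-3) by (simp_all add: between_less)
  then have "((i < k) \<noteq> (x < k)) = ((i < y) \<noteq> (x < y))"
    using ne by (smt (verit) less_trans linorder_neqE_nat not_less_iff_gr_or_eq)
  then show ?thesis
    by (simp add: between_less)
qed

text \<open>
  The points \<open>a'\<close>, \<open>c'\<close> are chosen so that joining their \<open>p\<close>-classes alone is already noncrossing
  and still separates \<open>b\<close> from \<open>d\<close>; then \<open>b'\<close>, \<open>d'\<close> are chosen in the same way relative to
  \<open>a'\<close>, \<open>c'\<close>. A class crossing the union of the four would cross one of the two pairs.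
\<close>

lemma crossing_jump:
  assumes p: "nceq n p" and S: "nceq n S" and T: "nceq n T"
    and pS: "p \<le> S" and pT: "p \<le> T"
    and ac: "S a c" and bd: "T b d" and lt: "a < b" "b < c" "c < d"
    and disj: "\<And>z. S a z \<Longrightarrow> \<not> T b z"
  shows "\<exists>X. X \<subseteq> {1..n} \<and> card X = 4 \<and> (\<forall>x\<in>X. \<forall>y\<in>X. p x y \<longrightarrow> x = y) \<and>
    nceq n (merge X p) \<and> unseparated p X \<and> (\<forall>x\<in>X. S a x \<or> T b x)"
proof -
  have sub: "p x y \<Longrightarrow> S x y" "p x y \<Longrightarrow> T x y" for x y
    using pS pT by auto
  have aa: "S a a" "T b b"
    using nceq_dom[OF S ac] nceq_dom[OF T bd] nceq_refl[OF S] nceq_refl[OF T] by auto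
  \<comment> \<open>Saturation under \<open>p\<close>: as \<open>p\<close> lies below
    \<open>T\<close>, the chord \<open>b d\<close> cannot cut a \<open>p\<close>-class inside the
    \<open>S\<close>-class of \<open>a\<close>, which is disjoint from the \<open>T\<close>-class of
    \<open>b\<close>.\<close>
  have "w \<in> {z. S a z \<and> between b d z}" if z: "z \<in> {z. S a z \<and> between b d z}" "p z w" for z w
    using same_side[OF T bd sub(2)[OF z(2)]] z nceq_trans[OF S _ sub(1)[OF z(2)]] disj by blast
  moreover have "c \<in> {z. S a z \<and> between b d z}" "a \<notin> {z. S a z \<and> between b d z}"
    using ac lt by (auto simp: between_iff)
  ultimately obtain c' a' where c': "S a c'" "between b d c'" and a': "\<not> (S a a' \<and> between b d a')"
    and ca: "S c' a'" "\<not> p c' a'" "nceq n (merge {c', a'} p)" "merge {c', a'} p \<le> S"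
    using exists_merge[OF p S pS _ _ _ nceq_sym[OF S ac], of "{z. S a z \<and> between b d z}"]
    by (metis (no_types, lifting) mem_Collect_eq)
  define S' where "S' = merge {c', a'} p"
  have S': "nceq n S'" "\<And>x y. S' x y \<Longrightarrow> S x y" "\<And>x y. p x y \<Longrightarrow> S' x y"
    using ca(3,4) by (auto simp: S'_def merge_def)
  have Sa': "S a a'"
    using nceq_trans[OF S c'(1) ca(1)] .
  then have Sb: "\<not> between b d a'"
    using a' by blast
  have prefl: "p x x" if "S a x \<or> T b x" for x
    using that nceq_dom[OF S] nceq_dom[OF T] nceq_refl[OF p] by blast
  have ac': "S' a' c'"
    using prefl c'(1) Sa' unfolding S'_def merge_def by blast
  have noS: "\<not> S' a' z" if "T b z" for z
    using that disj S'(2) nceq_trans[OF S Sa'] by blast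
  have ne: "z \<noteq> x" if "S a x" "T b z" for x z
    using that disj by blast
  have sides: "between a' c' b \<noteq> between a' c' d"
    using c'(2) Sb between_swap[of b a' c' d] ne[OF Sa' aa(2)] ne[OF c'(1) aa(2)] ne[OF Sa' bd] ne[OF c'(1) bd]
    by simp
  \<comment> \<open>The same saturation with the roles exchanged: \<open>S'\<close> relates
    \<open>a'\<close> to \<open>c'\<close>, so it bars \<open>p\<close>-classes from crossing this
    chord.\<close>
  have closed: "w \<in> {z. T b z \<and> between a' c' z}" if z: "z \<in> {z. T b z \<and> between a' c' z}" "p z w" for z w
    using same_side[OF S'(1) ac' S'(3)[OF z(2)]] z noS nceq_trans[OF T _ sub(2)[OF z(2)]] by blast
  have "\<exists>b' d'. T b b' \<and> T b' d' \<and> between a' c' b' \<and> \<not> between a' c' d' \<and> \<not> p b' d' \<and>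
      nceq n (merge {b', d'} p) \<and> merge {b', d'} p \<le> T"
  proof -
    obtain x0 y0 where xy0: "x0 \<in> {z. T b z \<and> between a' c' z}" "y0 \<notin> {z. T b z \<and> between a' c' z}" "T x0 y0"
      using sides bd nceq_sym[OF T bd] aa(2) by blast
    show ?thesis
    proof (rule exists_merge[OF p T pT closed xy0])
      fix x y
      assume xy: "x \<in> {z. T b z \<and> between a' c' z}" "y \<notin> {z. T b z \<and> between a' c' z}" "T x y"
        "\<not> p x y" "nceq n (merge {x, y} p)" "merge {x, y} p \<le> T"
      then have "T b y"
        using nceq_trans[OF T, of b x y] by blast
      then show ?thesis
        using xy by blast
    qed
  qed
  then obtain b' d' where b': "T b b'" "T b' d'" and bd': "between a' c' b'" "\<not> between a' c' d'" "\<not> p b' d'"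
    and T'1: "nceq n (merge {b', d'} p)" "merge {b', d'} p \<le> T"
    by blast
  define T' where "T' = merge {b', d'} p"
  have T': "nceq n T'" "\<And>x y. T' x y \<Longrightarrow> T x y" "\<And>x y. p x y \<Longrightarrow> T' x y"
    using T'1 by (auto simp: T'_def merge_def)
  have Td': "T b d'"
    using nceq_trans[OF T b'] .
  have bdT': "T' b' d'"
    using prefl b'(1) Td' unfolding T'_def merge_def by blast
  have noT: "\<not> T' b' z" if "S a z" for z
    using that disj T'(2) nceq_trans[OF T b'(1)] by blast
  \<comment> \<open>Points are moved within their \<open>p\<close>-classes one pair at a time:
    \<open>T'\<close> fixes the sides while \<open>a'\<close>, \<open>c'\<close> are replaced, then
    \<open>S'\<close> while \<open>b'\<close>, \<open>d'\<close> are.\<close>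
  have cross: "between u w v \<noteq> between u w z"
    if rep: "p a' u" "p c' w" "p b' v" "p d' z" for u v w z
  proof -
    have "S a u" "S a w" "T b v" "T b z"
      using nceq_trans[OF S Sa' sub(1)[OF rep(1)]] nceq_trans[OF S c'(1) sub(1)[OF rep(2)]]
        nceq_trans[OF T b'(1) sub(2)[OF rep(3)]] nceq_trans[OF T Td' sub(2)[OF rep(4)]] by auto
    note in_blocks = this
    have "between b' d' a' \<noteq> between b' d' c'"
      using bd' between_swap[of b' a' c' d'] ne[OF Sa' b'(1)] ne[OF c'(1) b'(1)] ne[OF Sa' Td'] ne[OF c'(1) Td']
      by simp
    then have "between b' d' u \<noteq> between b' d' w"
      using same_side[OF T'(1) bdT' T'(3)[OF rep(1)] noT[OF Sa']]
        same_side[OF T'(1) bdT' T'(3)[OF rep(2)] noT[OF c'(1)]] by simp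
    then have 1: "between u w b' \<noteq> between u w d'"
      using between_swap[of u b' d' w] ne[OF in_blocks(1) b'(1)] ne[OF in_blocks(2) b'(1)]
        ne[OF in_blocks(1) Td'] ne[OF in_blocks(2) Td'] by simp
    have uw: "S' u w"
      using nceq_trans[OF S'(1) nceq_sym[OF S'(1) S'(3)[OF rep(1)]] nceq_trans[OF S'(1) ac' S'(3)[OF rep(2)]]] .
    have "\<not> S' u b'" "\<not> S' u d'"
      using noS[OF b'(1)] noS[OF Td'] nceq_trans[OF S'(1) S'(3)[OF rep(1)]] by blast+
    then show ?thesis
      using 1 same_side[OF S'(1) uw S'(3)[OF rep(3)]] same_side[OF S'(1) uw S'(3)[OF rep(4)]] by simp
  qed
  define X where "X = {a', b', c', d'}"
  \<comment> \<open>Opposite corners of the crossing. Each corner has exactly one opposite, and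
    chords between the two opposite pairs cross; arguing through \<open>opp\<close> avoids cases on
    the four names.\<close>
  define opp where "opp = {(a', c'), (c', a'), (b', d'), (d', b')}"
  have XST: "S a a'" "S a c'" "T b b'" "T b d'"
    using Sa' c'(1) b'(1) Td' by auto
  have nop: "\<not> p x y" "\<not> p y x" if "S a x" "T b y" for x y
    using that disj sub nceq_trans[OF S] nceq_sym[OF p] by blast+
  have dist: "x = y" if "x \<in> X" "y \<in> X" "p x y" for x y
    using that ca(2) bd'(3) nceq_sym[OF p] nop[OF XST(1,3)] nop[OF XST(1,4)] nop[OF XST(2,3)] nop[OF XST(2,4)]
    unfolding X_def by auto
  have X4: "a' \<noteq> c'" "b' \<noteq> d'" "a' \<noteq> b'" "a' \<noteq> d'" "c' \<noteq> b'" "c' \<noteq> d'"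
    using ca(2) bd'(3) prefl XST ne by blast+
  have Xsub: "X \<subseteq> {1..n}" "card X = 4"
    using X4 nceq_dom[OF S XST(1)] nceq_dom[OF S XST(2)] nceq_dom[OF T XST(3)] nceq_dom[OF T XST(4)]
    unfolding X_def by auto
  have opp: "\<exists>y. (x, y) \<in> opp" if "x \<in> X" for x
    using that unfolding X_def opp_def by auto
  have oppX: "x \<in> X" "y \<in> X" "x \<noteq> y" if "(x, y) \<in> opp" for x y
    using that X4 unfolding X_def opp_def by auto
  have opp_inj: "x' = y' \<longleftrightarrow> x = y" "x' = y \<longleftrightarrow> x = y'" if "(x, x') \<in> opp" "(y, y') \<in> opp" for x x' y y'
    using that X4 unfolding opp_def by auto
  have reps: "u \<noteq> v" if "x \<in> X" "y \<in> X" "x \<noteq> y" "p x u" "p y v" for x y u v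
    using that dist nceq_trans[OF p] nceq_sym[OF p] by metis
  have cross2: "between u w v \<noteq> between u w z"
    if xy: "(x, x') \<in> {(a', c'), (c', a')}" "(y, y') \<in> {(b', d'), (d', b')}"
      and rep: "p x u" "p x' w" "p y v" "p y' z"
    for x x' y y' u v w z
  proof -
    have "x = a' \<and> x' = c' \<or> x = c' \<and> x' = a'" "y = b' \<and> y' = d' \<or> y = d' \<and> y' = b'"
      using xy by auto
    then consider "x = a'" "x' = c'" "y = b'" "y' = d'" | "x = a'" "x' = c'" "y = d'" "y' = b'"
      | "x = c'" "x' = a'" "y = b'" "y' = d'" | "x = c'" "x' = a'" "y = d'" "y' = b'"
      by blast
    then show ?thesis
    proof cases
      case 1
      then show ?thesis
        using cross[of u w v z] rep by simp
    next
      case 2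
      then show ?thesis
        using cross[of u w z v] rep by simp
    next
      case 3
      then show ?thesis
        using cross[of w u v z] rep between_commute[of w u] by simp
    next
      case 4
      then show ?thesis
        using cross[of w u z v] rep between_commute[of w u] by simp
    qed
  qed
  have crossX: "between u w v \<noteq> between u w z"
    if xy: "(x, x') \<in> opp" "(y, y') \<in> opp" "x \<noteq> y" "x \<noteq> y'" and rep: "p x u" "p x' w" "p y v" "p y' z"
    for x x' y y' u v w z
  proof -
    have uvwz: "v \<noteq> u" "v \<noteq> w" "z \<noteq> u" "z \<noteq> w"
      using reps oppX xy rep opp_inj[OF xy(1,2)] by metis+
    have sw: "between u w v \<noteq> between u w z \<longleftrightarrow> between v z u \<noteq> between v z w"
      using between_swap[OF uvwz] by simp
    consider "(x, x') \<in> {(a', c'), (c', a')}" "(y, y') \<in> {(b', d'), (d', b')}"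
      | "(y, y') \<in> {(a', c'), (c', a')}" "(x, x') \<in> {(b', d'), (d', b')}"
      using xy unfolding opp_def by auto
    then show ?thesis
    proof cases
      case 1
      then show ?thesis
        using cross2[OF 1 rep] by blast
    next
      case 2
      then show ?thesis
        using cross2[OF 2 rep(3,4,1,2)] sw by blast
    qed
  qed
  have refl: "p e e" if "e \<in> X" for e
    using that prefl XST unfolding X_def by blast
  \<comment> \<open>The witness is the fourth corner \<open>z'\<close>: chords from \<open>t\<close>
    and from \<open>u\<close> to \<open>v\<close> both cross the chord \<open>w z'\<close>, as
    \<open>between_opposite\<close> requires.\<close>
  have through: "between v w t = between v w u"
    if o: "(x, v') \<in> opp" "(z, z') \<in> opp" "x \<noteq> z" "x \<noteq> z'" and rep: "p x t" "p x u" "p v' v" "p z w"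
    for x z v' z' t u v w
  proof -
    have in_X: "x \<in> X" "v' \<in> X" "z \<in> X" "z' \<in> X" and ne: "x \<noteq> v'" "z \<noteq> z'" "v' \<noteq> z" "v' \<noteq> z'"
      using oppX[OF o(1)] oppX[OF o(2)] opp_inj[OF o(1,2)] o(3,4) by auto
    note pz = refl[OF in_X(4)]
    have "between t v w \<noteq> between t v z'" "between u v w \<noteq> between u v z'"
      using crossX[OF o rep(1,3,4) pz] crossX[OF o rep(2,3,4) pz] by auto
    moreover have "t \<notin> {v, w, z'}" "u \<notin> {v, w, z'}"
      using reps[OF in_X(1,2) ne(1) _ rep(3)] reps[OF in_X(1,3) o(3) _ rep(4)] reps[OF in_X(1,4) o(4) _ pz]
        rep(1,2) by auto
    moreover have "v \<notin> {w, z'}" "w \<noteq> z'"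
      using reps[OF in_X(2,3) ne(3) rep(3,4)] reps[OF in_X(2,4) ne(4) rep(3) pz]
        reps[OF in_X(3,4) ne(2) rep(4) pz] by auto
    ultimately show ?thesis
      by (rule between_opposite)
  qed
  have unsep: "unseparated p X"
    unfolding unseparated_def
  proof (intro ballI allI impI)
    fix x y z t u v w
    assume X: "x \<in> X" "y \<in> X" "z \<in> X" "x \<noteq> y" "x \<noteq> z" "y \<noteq> z"
      and rep: "p x t" "p x u" "p y v" "p z w"
    obtain x' where ox: "(x, x') \<in> opp"
      using opp[OF X(1)] by blast
    obtain y' where oy: "(y, y') \<in> opp"
      using opp[OF X(2)] by blast
    obtain z' where oz: "(z, z') \<in> opp"
      using opp[OF X(3)] by blast
    consider "x' = y" | "x' = z" | "x' \<noteq> y" "x' \<noteq> z"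
      by blast
    then show "between v w t = between v w u"
    proof cases
      case 1
      then have "x \<noteq> z'"
        using opp_inj(2)[OF ox oz] X(6) by simp
      then show ?thesis
        using through[OF ox oz X(5) _ rep(1,2) _ rep(4)] rep(3) 1 by simp
    next
      case 2
      then have "x \<noteq> y'"
        using opp_inj(2)[OF ox oy] X(6) by simp
      then show ?thesis
        using through[OF ox oy X(4) _ rep(1,2) _ rep(3)] rep(4) 2 by (simp add: between_commute[of v w])
    next
      case 3
      \<comment> \<open>Here \<open>y\<close> and \<open>z\<close> are opposite, and both
        \<open>t\<close> and \<open>u\<close> lie across the chord \<open>v w\<close> from
        \<open>x'\<close>.\<close>
      have zy: "y' = z"
        using X ox oy 3 X4 unfolding X_def opp_def by auto
      then have ne: "y \<noteq> x" "y \<noteq> x'"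
        using X(4) 3 by auto
      have px: "p x' x'"
        using refl oppX[OF ox] by blast
      have "between v w t \<noteq> between v w x'" "between v w u \<noteq> between v w x'"
        using crossX[OF oy ox ne rep(3) _ _ px] rep zy by simp_all
      then show ?thesis
        by blast
    qed
  qed
  \<comment> \<open>\<open>S'\<close> and \<open>T'\<close> each join one opposite pair and are
    noncrossing, so a chord between opposite classes cannot separate a class that is not joined at
    all.\<close>
  have side: "between u w j = between u w l"
    if o: "(x, x') \<in> opp" and rep: "p x u" "p x' w" and jl: "p j l" and out: "\<forall>x\<in>X. \<not> p j x" for x x' u w j l
  proof -
    define R where "R = (if x = a' \<or> x = c' then S' else T')"
    have R: "nceq n R" "\<And>x y. p x y \<Longrightarrow> R x y" "R x x'"
      using S' T' ac' bdT' nceq_sym[OF S'(1) ac'] nceq_sym[OF T'(1) bdT'] o X4 unfolding R_def opp_def by auto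
    have uw: "R u w"
      using nceq_trans[OF R(1) nceq_sym[OF R(1) R(2)[OF rep(1)]] nceq_trans[OF R(1) R(3) R(2)[OF rep(2)]]] .
    have "\<not> R u j"
    proof
      assume "R u j"
      moreover have "R = merge {x, x'} p"
        using o X4 unfolding R_def S'_def T'_def opp_def by (auto simp: insert_commute)
      ultimately have "p u j \<or> (\<exists>y\<in>{x, x'}. p j y)"
        by (auto simp: merge_def)
      then show False
        using out oppX[OF o] nceq_sym[OF p] nceq_trans[OF p] rep(1) by blast
    qed
    then show ?thesis
      using same_side[OF R(1) uw R(2)[OF jl]] by blast
  qed
  have split: False
    if ik: "x \<in> X" "y \<in> X" "p x i" "p y k" "\<not> p i k" and jl: "p j l" "\<forall>x\<in>X. \<not> p j x"
      and bt: "between i k j \<noteq> between i k l" for x y i k j l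
  proof -
    have xy: "x \<noteq> y"
      using ik nceq_sym[OF p] nceq_trans[OF p] by blast
    obtain x' y' where o: "(x, x') \<in> opp" "(y, y') \<in> opp"
      using opp ik by blast
    have refl: "p x' x'" "p y' y'"
      using prefl XST oppX[OF o(1)] oppX[OF o(2)] unfolding X_def by blast+
    show False
    proof (cases "y = x'")
      case True
      then show False
        using side[OF o(1) ik(3) _ jl] ik(4) bt by blast
    next
      case False
      have ne': "x \<noteq> y'" "x' \<noteq> y'"
        using opp_inj[OF o] False xy by metis+
      have jlX: "j \<noteq> e" "l \<noteq> e" if "z \<in> X" "p z e" for z e
        using that jl nceq_sym[OF p] nceq_trans[OF p] by blast+
      \<comment> \<open>An untouched class separating two corners that are not opposite would keep
        the chords to their opposites apart, yet these chords cross.\<close>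
      have "between i x' k = between i x' y'"
      proof (rule between_uncrossed[OF bt])
        show "between i x' j = between i x' l" "between k y' j = between k y' l"
          using side[OF o(1) ik(3) refl(1) jl] side[OF o(2) ik(4) refl(2) jl] .
        show "j \<notin> {i, k, x', y'}" "l \<notin> {i, k, x', y'}"
          using jlX ik refl oppX[OF o(1)] oppX[OF o(2)] by blast+
        show "i \<notin> {k, x', y'}" "k \<notin> {x', y'}" "x' \<noteq> y'"
          using reps[OF ik(1,2) xy ik(3,4)] reps[OF ik(1) oppX(2)[OF o(1)] oppX(3)[OF o(1)] ik(3) refl(1)]
            reps[OF ik(1) oppX(2)[OF o(2)] ne'(1) ik(3) refl(2)]
            reps[OF ik(2) oppX(2)[OF o(1)] False ik(4) refl(1)]
            reps[OF ik(2) oppX(2)[OF o(2)] oppX(3)[OF o(2)] ik(4) refl(2)] ne'(2) by auto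
      qed
      then show False
        using crossX[OF o xy ne'(1) ik(3) refl(1) ik(4) refl(2)] by blast
    qed
  qed
  have nc: "merge X p i j"
    if ijkl: "i < j" "j < k" "k < l" and m: "merge X p i k" "merge X p j l" for i j k l
  proof (rule ccontr)
    assume no: "\<not> merge X p i j"
    have bt: "between i k j \<noteq> between i k l" "between j l i \<noteq> between j l k"
      using ijkl by (auto simp: between_iff)
    consider "p i k" "p j l" | "p i k" "\<not> p j l" | "\<not> p i k" "p j l" | "\<not> p i k" "\<not> p j l"
      by blast
    then show False
    proof cases
      case 1
      then show False
        using nceq_noncrossing[OF p ijkl] no by (auto simp: merge_def)
    next
      case 2
      then obtain x y where "x \<in> X" "p x j" "y \<in> X" "p y l"
        using m(2) nceq_sym[OF p] unfolding merge_def by blast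
      moreover have "\<forall>x\<in>X. \<not> p i x"
        using no calculation nceq_sym[OF p] unfolding merge_def by blast
      ultimately show False
        using split[of x y j l i k] 2 bt(2) by blast
    next
      case 3
      then obtain x y where "x \<in> X" "p x i" "y \<in> X" "p y k"
        using m(1) nceq_sym[OF p] unfolding merge_def by blast
      moreover have "\<forall>x\<in>X. \<not> p j x"
        using no calculation nceq_sym[OF p] unfolding merge_def by blast
      ultimately show False
        using split[of x y i k j l] 3 bt(1) by blast
    next
      case 4
      then show False
        using m no unfolding merge_def by blast
    qed
  qed
  have "\<forall>x\<in>X. S a x \<or> T b x"
    using XST by (auto simp: X_def)
  moreover have "\<forall>x\<in>X. \<forall>y\<in>X. p x y \<longrightarrow> x = y"
    using dist by blast
  moreover have "nceq n (merge X p)"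
    by (rule nceq_merge[OF p nc])
  ultimately show ?thesis
    using Xsub unsep by (intro exI[of _ X] conjI)
qed

subsection \<open>Chains of noncrossing partitions\<close>

definition same :: "'a set set \<Rightarrow> 'a \<Rightarrow> 'a \<Rightarrow> bool" where
  "same P i j \<longleftrightarrow> (\<exists>B\<in>P. i \<in> B \<and> j \<in> B)"

lemma partition_on_unique:
  "partition_on A P \<Longrightarrow> B \<in> P \<Longrightarrow> C \<in> P \<Longrightarrow> i \<in> B \<Longrightarrow> i \<in> C \<Longrightarrow> B = C"
  unfolding partition_on_def disjoint_def by blast

lemma nceq_same:
  assumes P: "partition_on {1..n} P" and nc: "noncrossing P"
  shows "nceq n (same P)"
  unfolding nceq_def
proof (intro conjI allI impI ballI)
  fix i j k
  show "same P i k" if "same P i j" "same P j k"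
    using that partition_on_unique[OF P] unfolding same_def by metis
  show "i \<in> {1..n}" "j \<in> {1..n}" if "same P i j"
    using that P unfolding same_def partition_on_def by blast+
  show "same P i i" if "i \<in> {1..n}"
    using that P unfolding same_def partition_on_def by blast
  show "same P j i" if "same P i j"
    using that unfolding same_def by blast
next
  fix a b c d :: nat
  assume lt: "a < b" "b < c" "c < d" and "same P a c" "same P b d"
  then obtain B C where BC: "B \<in> P" "C \<in> P" "a \<in> B" "c \<in> B" "b \<in> C" "d \<in> C"
    unfolding same_def by blast
  have fin: "finite X" if "X \<in> P" for X
    using that P finite_subset[of X "{1..n}"] unfolding partition_on_def by blast
  have "card {a, c} \<le> card B" "card {b, d} \<le> card C"
    using BC fin by (auto intro!: card_mono)
  then have "B \<in> blocks P" "C \<in> blocks P"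
    using BC lt by (auto simp: blocks_def)
  moreover have "crossing B C" if "B \<inter> C = {}"
    using that BC lt unfolding crossing_def by blast
  ultimately have "B \<inter> C \<noteq> {}"
    using nc unfolding noncrossing_def by blast
  then have "B = C"
    using BC P unfolding partition_on_def disjoint_def by blast
  then show "same P a b"
    using BC unfolding same_def by blast
qed

lemma NCP_partition_on: "P \<in> NCP n \<Longrightarrow> partition_on {1..n} P"
  by (simp add: NCP_def)

lemma NCP_nceq: "P \<in> NCP n \<Longrightarrow> nceq n (same P)"
  by (simp add: NCP_def nceq_same)

lemma finite_NCP: "finite (NCP n)"
  by (rule finite_subset[of _ "Pow (Pow {1..n})"]) (auto simp: NCP_def partition_on_def)

lemma strictly_refines_le: "strictly_refines n P Q \<Longrightarrow> same P \<le> same Q"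
  unfolding strictly_refines_def refines_def same_def le_fun_def le_bool_def by blast

lemma NCP_chain_subset: "NCP_chain n F \<Longrightarrow> F \<subseteq> NCP n"
  by (simp add: NCP_chain_def pred_on.chain_def)

lemma NCP_chain_comparable:
  "NCP_chain n F \<Longrightarrow> P \<in> F \<Longrightarrow> Q \<in> F \<Longrightarrow> P = Q \<or> strictly_refines n P Q \<or> strictly_refines n Q P"
  unfolding NCP_chain_def pred_on.chain_def by blast

lemma block_same:
  assumes "partition_on A P" "B \<in> P" "i \<in> B"
  shows "same P i j \<longleftrightarrow> j \<in> B"
  using assms partition_on_unique[OF assms(1)] unfolding same_def by blast

text \<open>Blocks around \<open>i\<close> in a chain are nested, so the least one exists and occurs
  in a member where \<open>i\<close> is not a singleton, which therefore relates \<open>i\<close> to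
  \<open>j\<close>. If \<open>i\<close> is a singleton throughout, the default value
  \<open>{1..n}\<close> of \<open>min_block\<close> contains \<open>j\<close>.\<close>

lemma covered_min_block:
  assumes F: "NCP_chain n F" and ij: "(i, j) \<in> covered n (same ` F)"
  shows "j \<in> min_block n F i"
proof (cases "\<forall>P\<in>F. {i} \<in> P")
  case True
  then show ?thesis
    using ij by (simp add: min_block_def covered_def)
next
  case False
  define S where "S = {\<sigma>. i \<in> \<sigma> \<and> (\<exists>P\<in>F. \<sigma> \<in> blocks P)}"
  have part: "partition_on {1..n} P" if "P \<in> F" for P
    using that NCP_chain_subset[OF F] NCP_partition_on by blast
  have sub: "S \<subseteq> Pow {1..n}"
    using part unfolding S_def blocks_def partition_on_def by blast
  then have "finite S"
    by (rule finite_subset) simp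
  moreover have "S \<noteq> {}"
  proof -
    obtain P where P: "P \<in> F" "{i} \<notin> P"
      using False by blast
    obtain B where B: "B \<in> P" "i \<in> B"
      using part[OF P(1)] ij unfolding partition_on_def covered_def by blast
    have "finite B"
      using B(1) part[OF P(1)] finite_subset[of B "{1..n}"] unfolding partition_on_def by blast
    moreover obtain k where "k \<in> B" "k \<noteq> i"
      using B P(2) by (metis empty_iff insertI1 singletonD subsetI subset_antisym subset_singletonD)
    ultimately have "card {i, k} \<le> card B"
      using B by (intro card_mono) auto
    then have "B \<in> blocks P"
      using B \<open>k \<noteq> i\<close> by (simp add: blocks_def)
    then show ?thesis
      using B P unfolding S_def by blast
  qed
  ultimately obtain m where m: "m \<in> S" "\<And>\<sigma>. \<sigma> \<in> S \<Longrightarrow> \<sigma> \<subseteq> m \<Longrightarrow> m = \<sigma>"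
    using finite_has_minimal[of S] by blast
  have least: "m \<subseteq> \<sigma>" if s: "\<sigma> \<in> S" for \<sigma>
  proof -
    obtain P Q where PQ: "P \<in> F" "m \<in> P" "i \<in> m" "Q \<in> F" "\<sigma> \<in> Q" "i \<in> \<sigma>"
      using m(1) s unfolding S_def blocks_def by blast
    have "m = {k. same P i k}" "\<sigma> = {k. same Q i k}"
      using block_same[OF part] PQ by auto
    moreover have "same P \<le> same Q \<or> same Q \<le> same P"
      using NCP_chain_comparable[OF F PQ(1,4)] strictly_refines_le by blast
    ultimately have "m \<subseteq> \<sigma> \<or> \<sigma> \<subseteq> m"
      by (auto dest: predicate2D)
    then show ?thesis
      using m(2)[OF s] by blast
  qed
  have "min_block n F i = (LEAST \<sigma>. \<sigma> \<in> S)"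
    unfolding min_block_def S_def using False by (simp only: if_False mem_Collect_eq)
  also have "\<dots> = m"
    by (rule Least_equality) (use m(1) least in auto)
  finally have min: "min_block n F i = m" .
  obtain P where P: "P \<in> F" "m \<in> P" "i \<in> m" "card m > 1"
    using m(1) unfolding S_def blocks_def by blast
  have "\<not> m \<subseteq> {i}"
    using P(4) card_mono[of "{i}" m] by auto
  then obtain k where "k \<in> m" "k \<noteq> i"
    by blast
  then have "same P i j"
    using ij P block_same[OF part[OF P(1)] P(2,3)] unfolding covered_def by blast
  then show ?thesis
    using block_same[OF part[OF P(1)] P(2,3)] by (simp add: min)
qed

text \<open>The order needed is the partial one on relations; the list is built from its end, a
  maximal element of a totally ordered set being the greatest.\<close>

lemma exists_sorted_list:
  fixes S :: "'a :: order set"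
  assumes "finite S" "\<And>x y. x \<in> S \<Longrightarrow> y \<in> S \<Longrightarrow> x \<le> y \<or> y \<le> x"
  shows "\<exists>L. set L = S \<and> sorted_wrt (\<le>) L"
  using assms
proof (induction "card S" arbitrary: S)
  case 0
  then show ?case
    by (intro exI[of _ "[]"]) auto
next
  case (Suc k)
  then have "S \<noteq> {}"
    by auto
  then obtain m where m: "m \<in> S" "\<And>x. x \<in> S \<Longrightarrow> m \<le> x \<Longrightarrow> m = x"
    using finite_has_maximal[OF Suc.prems(1)] by blast
  have "k = card (S - {m})"
    using Suc.hyps(2) m(1) Suc.prems(1) by simp
  then obtain L where L: "set L = S - {m}" "sorted_wrt (\<le>) L"
    using Suc.hyps(1)[of "S - {m}"] Suc.prems by auto
  show ?case
    using L m Suc.prems(2) by (intro exI[of _ "L @ [m]"]) (auto simp: sorted_wrt_append)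
qed

section \<open>Walks obtained from chains and from condition III\<close>

lemma NCP_chain_walk:
  assumes C: "NCP_chain n C"
  shows "\<exists>m V. walk n (replicate m 2) (eqbot n) V \<and> V \<subseteq> covered n (same ` C)"
proof -
  have "finite (same ` C)"
    using finite_subset[OF NCP_chain_subset[OF C] finite_NCP] by simp
  moreover have "x \<le> y \<or> y \<le> x" if "x \<in> same ` C" "y \<in> same ` C" for x y
    using that NCP_chain_comparable[OF C] strictly_refines_le by blast
  ultimately obtain L where L: "set L = same ` C" "sorted_wrt (\<le>) L"
    using exists_sorted_list[of "same ` C"] by blast
  have nc: "nceq n R" if "R \<in> set L" for R
    using that L(1) NCP_chain_subset[OF C] NCP_nceq by auto
  have "\<exists>m V'. walk n (replicate m 2 @ []) (hd (eqbot n # L @ [eqtop n])) V' \<and>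
      V' \<subseteq> covered n (same ` C) \<union> {}"
  proof (rule walk_chain)
    show "sorted_wrt (\<le>) (eqbot n # L @ [eqtop n])"
      using L(2) nc eqbot_le le_eqtop nceq_eqtop by (auto simp: sorted_wrt_append)
  qed (use L nc nceq_eqbot nceq_eqtop walk_top in auto)
  then show ?thesis
    by simp
qed

text \<open>Any noncrossing relation above both partitions must put the two crossing blocks into one
  class, so the four points of \<open>crossing_jump\<close> can be joined without leaving
  \<open>q\<close>.\<close>

lemma cross_partitions_jump:
  assumes S: "S \<in> NCP n" and T: "T \<in> NCP n" and cr: "cross_partitions S T"
    and p: "nceq n p" "p \<le> same S" "p \<le> same T"
    and q: "nceq n q" "same S \<le> q" "same T \<le> q"
  shows "\<exists>X. X \<subseteq> {1..n} \<and> card X = 4 \<and> (\<forall>x\<in>X. \<forall>y\<in>X. p x y \<longrightarrow> x = y) \<and>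
    nceq n (merge X p) \<and> unseparated p X \<and> merge X p \<le> q"
proof -
  have main: ?thesis
    if S: "S \<in> NCP n" and T: "T \<in> NCP n" and p': "p \<le> same S" "p \<le> same T"
      and q': "same S \<le> q" "same T \<le> q"
      and st: "\<sigma> \<in> S" "\<tau> \<in> T" "\<sigma> \<inter> \<tau> = {}" "a \<in> \<sigma>" "c \<in> \<sigma>" "b \<in> \<tau>" "d \<in> \<tau>"
      and lt: "a < b" "b < c" "c < d"
    for S T \<sigma> \<tau> a b c d
  proof -
    have s: "same S a i \<longleftrightarrow> i \<in> \<sigma>" "same T b i \<longleftrightarrow> i \<in> \<tau>" for i
      using block_same[OF NCP_partition_on[OF S] st(1,4)] block_same[OF NCP_partition_on[OF T] st(2,6)] .
    have ac: "same S a c" and bd: "same T b d" and disj: "\<And>z. same S a z \<Longrightarrow> \<not> same T b z"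
      using s st by auto
    obtain X where X: "X \<subseteq> {1..n}" "card X = 4" "\<forall>x\<in>X. \<forall>y\<in>X. p x y \<longrightarrow> x = y"
      "nceq n (merge X p)" "unseparated p X" "\<forall>x\<in>X. same S a x \<or> same T b x"
      using crossing_jump[OF p(1) NCP_nceq[OF S] NCP_nceq[OF T] p' ac bd lt disj] by blast
    have qab: "q a b"
      using nceq_noncrossing[OF q(1) lt] q' ac bd by blast
    have "q a x" if "x \<in> X" for x
      using X(6) that q' nceq_trans[OF q(1) qab] by blast
    then have "q x y" if "x \<in> X" "y \<in> X" for x y
      using that nceq_trans[OF q(1) nceq_sym[OF q(1)]] by blast
    then have "merge X p \<le> q"
      using merge_le[OF q(1) order_trans[OF p'(1) q'(1)]] by blast
    then show ?thesis
      using X(1-5) by (intro exI[of _ X] conjI)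
  qed
  obtain \<sigma> \<tau> where st: "\<sigma> \<in> S" "\<tau> \<in> T" "crossing \<sigma> \<tau>"
    using cr unfolding cross_partitions_def blocks_def by blast
  then obtain a b c d where abcd: "a \<in> \<sigma>" "c \<in> \<sigma>" "b \<in> \<tau>" "d \<in> \<tau>" "\<sigma> \<inter> \<tau> = {}"
    "a < b \<and> b < c \<and> c < d \<or> b < a \<and> a < d \<and> d < c"
    unfolding crossing_def by blast
  have "\<tau> \<inter> \<sigma> = {}"
    using abcd(5) by blast
  from abcd(6) show ?thesis
  proof (elim disjE conjE)
    assume "a < b" "b < c" "c < d"
    then show ?thesis
      using main[OF S T p(2,3) q(2,3) st(1,2) abcd(5,1-4)] by blast
  next
    assume "b < a" "a < d" "d < c"
    then show ?thesis
      using main[OF T S p(3,2) q(3,2) st(2,1) \<open>\<tau> \<inter> \<sigma> = {}\<close> abcd(3,4,1,2)] by blast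
  qed
qed

lemma cond_III_walk:
  assumes F: "NCP_chain n F" and III: "cond_III n F"
  shows "\<exists>a b V. walk n (replicate a 2 @ 4 # replicate b 2) (eqbot n) V \<and> V \<subseteq> covered n (same ` F)"
proof -
  obtain Ps S T where Ps: "Ps \<noteq> []" "set Ps = F" "sorted_wrt (strictly_refines n) Ps"
    and ST: "S \<in> NCP n" "T \<in> NCP n" "cross_partitions S T"
    and gap: "(\<exists>i. Suc i < length Ps \<and>
               strictly_refines n (Ps ! i) S \<and> strictly_refines n S (Ps ! Suc i) \<and>
               strictly_refines n (Ps ! i) T \<and> strictly_refines n T (Ps ! Suc i)) \<or>
            (strictly_refines n S (hd Ps) \<and> strictly_refines n T (hd Ps)) \<or>
            (strictly_refines n (last Ps) S \<and> strictly_refines n (last Ps) T)"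
    using III unfolding cond_III_def by blast
  define L where "L = map same Ps"
  have L: "set L = same ` F" "sorted_wrt (\<le>) L"
    using Ps(2) sorted_wrt_mono_rel[OF strictly_refines_le Ps(3), of "\<lambda>_ _. n"]
    by (simp_all add: L_def sorted_wrt_map)
  have nc: "nceq n R" if "R \<in> set L" for R
    using that L(1) NCP_chain_subset[OF F] NCP_nceq by auto
  note nST = NCP_nceq[OF ST(1)] NCP_nceq[OF ST(2)]
  \<comment> \<open>The three positions allowed by III become one: the chain is cut at the gap, and
    the bottom or top relation stands in for a missing neighbour.\<close>
  have "\<exists>lo hi. L = lo @ hi \<and> last (eqbot n # lo) \<le> same S \<and> last (eqbot n # lo) \<le> same T \<and>
      same S \<le> hd (hi @ [eqtop n]) \<and> same T \<le> hd (hi @ [eqtop n])"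
    using gap
  proof (elim disjE exE)
    fix i
    assume i: "Suc i < length Ps \<and>
               strictly_refines n (Ps ! i) S \<and> strictly_refines n S (Ps ! Suc i) \<and>
               strictly_refines n (Ps ! i) T \<and> strictly_refines n T (Ps ! Suc i)"
    then have "last (eqbot n # take (Suc i) L) = same (Ps ! i)"
      "hd (drop (Suc i) L @ [eqtop n]) = same (Ps ! Suc i)"
      by (auto simp: L_def take_Suc_conv_app_nth hd_append hd_drop_conv_nth)
    then show ?thesis
      using i[THEN conjunct2] by - (rule exI[of _ "take (Suc i) L"], rule exI[of _ "drop (Suc i) L"],
        simp only: append_take_drop_id, metis strictly_refines_le)
  next
    assume "strictly_refines n S (hd Ps) \<and> strictly_refines n T (hd Ps)"
    then show ?thesis
      using Ps(1) nST eqbot_le by - (rule exI[of _ "[]"], rule exI[of _ L],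
        auto simp: L_def hd_append hd_map dest: strictly_refines_le)
  next
    assume "strictly_refines n (last Ps) S \<and> strictly_refines n (last Ps) T"
    then show ?thesis
      using Ps(1) nST le_eqtop by - (rule exI[of _ L], rule exI[of _ "[]"],
        auto simp: L_def last_map dest: strictly_refines_le)
  qed
  then obtain lo hi where lohi: "L = lo @ hi"
    and p: "last (eqbot n # lo) \<le> same S" "last (eqbot n # lo) \<le> same T"
    and q: "same S \<le> hd (hi @ [eqtop n])" "same T \<le> hd (hi @ [eqtop n])"
    by blast
  define lower upper where "lower = eqbot n # lo" and "upper = hi @ [eqtop n]"
  have ne: "lower \<noteq> []" "upper \<noteq> []"
    by (auto simp: lower_def upper_def)
  have ncs: "nceq n R" if "R \<in> set lower \<or> R \<in> set upper" for R
    using that nc nceq_eqbot nceq_eqtop by (auto simp: lower_def upper_def lohi)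
  have "sorted_wrt (\<le>) (lower @ upper)"
    using L(2) nc eqbot_le le_eqtop nceq_eqtop by (auto simp: sorted_wrt_append lohi lower_def upper_def)
  then have srt: "sorted_wrt (\<le>) lower" "sorted_wrt (\<le>) upper"
    by (auto simp: sorted_wrt_append)
  have lo: "R \<le> last lower" if "R \<in> set lower" for R
    using that srt(1) by (cases lower rule: rev_cases) (auto simp: sorted_wrt_append)
  have hi: "hd upper \<le> R" if "R \<in> set upper" for R
    using that srt(2) by (cases upper) auto
  have F': "R \<in> set lower \<or> R \<in> set upper" if "R \<in> same ` F" for R
    using that L(1) by (auto simp: lohi lower_def upper_def)
  have pq: "last lower \<le> hd upper"
    using p(1) q(1) unfolding lower_def upper_def by (rule order_trans)
  obtain X where X: "X \<subseteq> {1..n}" "card X = 4" "\<forall>x\<in>X. \<forall>y\<in>X. last lower x y \<longrightarrow> x = y"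
    "nceq n (merge X (last lower))" "unseparated (last lower) X" "merge X (last lower) \<le> hd upper"
    using cross_partitions_jump[OF ST ncs p[folded lower_def] ncs q[folded upper_def]] ne by auto
  have "\<exists>m V'. walk n (replicate m 2 @ []) (hd upper) V' \<and> V' \<subseteq> covered n (same ` F) \<union> {}"
  proof (rule walk_chain[OF ne(2) _ _ srt(2)])
    fix R assume "R \<in> same ` F"
    from F'[OF this] show "R \<le> hd upper \<or> R \<in> set upper \<or> last upper \<le> R"
      using order_trans[OF lo pq] by blast
  qed (use ncs walk_top nceq_eqtop in \<open>auto simp: upper_def\<close>)
  then obtain m1 V1 where V1: "walk n (replicate m1 2) (hd upper) V1" "V1 \<subseteq> covered n (same ` F)"
    by auto
  have "\<exists>m V'. walk n (4 # replicate m 2 @ replicate m1 2) (last lower) V' \<and>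
      V' \<subseteq> covered n (same ` F) \<union> V1"
  proof (rule walk_jump[OF _ V1(1) _ pq X(1,2) _ _ X(4,6,5)])
    fix R assume "R \<in> same ` F"
    from F'[OF this] show "R \<le> last lower \<or> hd upper \<le> R"
      using lo hi by blast
  qed (use X(3) ncs ne in simp_all)
  then obtain m2 V2 where V2: "walk n (4 # replicate m2 2 @ replicate m1 2) (last lower) V2"
    "V2 \<subseteq> covered n (same ` F)"
    using V1(2) by blast
  have "\<exists>m V'. walk n (replicate m 2 @ 4 # replicate m2 2 @ replicate m1 2) (hd lower) V' \<and>
      V' \<subseteq> covered n (same ` F) \<union> V2"
  proof (rule walk_chain[OF ne(1) _ V2(1) srt(1)])
    fix R assume "R \<in> same ` F"
    from F'[OF this] show "R \<le> hd lower \<or> R \<in> set lower \<or> last lower \<le> R"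
      using order_trans[OF pq hi] by blast
  qed (use ncs ne in auto)
  then obtain m3 V where "walk n (replicate m3 2 @ 4 # replicate (m2 + m1) 2) (eqbot n) V"
    "V \<subseteq> covered n (same ` F)"
    using V2(2) by (auto simp: lower_def replicate_add)
  then show ?thesis
    by blast
qed

subsection \<open>Rotations and reflections\<close>

text \<open>A pullback along \<open>\<pi>\<close>, so that no inverse map has to be named.\<close>

definition act :: "nat \<Rightarrow> (nat \<Rightarrow> nat) \<Rightarrow> (nat \<Rightarrow> nat \<Rightarrow> bool) \<Rightarrow> nat \<Rightarrow> nat \<Rightarrow> bool" where
  "act n \<pi> r i j \<longleftrightarrow> i \<in> {1..n} \<and> j \<in> {1..n} \<and> r (\<pi> i) (\<pi> j)"

definition nc_symmetry :: "nat \<Rightarrow> (nat \<Rightarrow> nat) \<Rightarrow> bool" where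
  "nc_symmetry n \<pi> \<longleftrightarrow> bij_betw \<pi> {1..n} {1..n} \<and>
     (\<forall>i\<in>{1..n}. \<forall>j\<in>{1..n}. \<pi> j = cprev n (\<pi> i) \<or> \<pi> j = cnext n (\<pi> i) \<longleftrightarrow> j = cprev n i \<or> j = cnext n i) \<and>
     (\<forall>r. nceq n r \<longrightarrow> nceq n (act n \<pi> r))"

lemma act_merge:
  assumes "bij_betw \<pi> {1..n} {1..n}" "X \<subseteq> {1..n}"
  shows "act n \<pi> (merge X r) = merge {x \<in> {1..n}. \<pi> x \<in> X} (act n \<pi> r)"
proof (intro ext)
  fix i j
  define X' where "X' = {x \<in> {1..n}. \<pi> x \<in> X}"
  have "\<pi> ` X' = \<pi> ` {1..n} \<inter> X"
    unfolding X'_def by blast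
  then have "X = \<pi> ` X'"
    using assms(2) by (simp only: bij_betw_imp_surj_on[OF assms(1)] Int_absorb1)
  then have ex: "(\<exists>x\<in>X. r (\<pi> k) x) \<longleftrightarrow> (\<exists>x\<in>X'. r (\<pi> k) (\<pi> x))" for k
    by simp
  show "act n \<pi> (merge X r) i j = merge {x \<in> {1..n}. \<pi> x \<in> X} (act n \<pi> r) i j"
  proof -
    have "(\<exists>x\<in>X'. act n \<pi> r k x) \<longleftrightarrow> k \<in> {1..n} \<and> (\<exists>x\<in>X. r (\<pi> k) x)" for k
      unfolding ex act_def by (auto simp: X'_def)
    then show ?thesis
      unfolding X'_def[symmetric] act_def[of n \<pi> "merge X r"] merge_def
      by (simp add: act_def) blast
  qed
qed

lemma flags_act:
  assumes \<pi>: "nc_symmetry n \<pi>" and r: "nceq n r"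
  shows "flags n (act n \<pi> r) (act n \<pi> s) = {(i, j). i \<in> {1..n} \<and> j \<in> {1..n} \<and> (\<pi> i, \<pi> j) \<in> flags n r s}"
proof -
  have bij: "bij_betw \<pi> {1..n} {1..n}"
    using \<pi> by (simp add: nc_symmetry_def)
  have single: "(\<forall>k. act n \<pi> r i k \<longrightarrow> k = i) \<longleftrightarrow> (\<forall>k. r (\<pi> i) k \<longrightarrow> k = \<pi> i)" if i: "i \<in> {1..n}" for i
  proof
    assume *: "\<forall>k. act n \<pi> r i k \<longrightarrow> k = i"
    show "\<forall>k. r (\<pi> i) k \<longrightarrow> k = \<pi> i"
    proof (intro allI impI)
      fix k
      assume k: "r (\<pi> i) k"
      then obtain l where "l \<in> {1..n}" "k = \<pi> l"
        using nceq_dom[OF r k] bij_betw_imp_surj_on[OF bij] by (metis imageE)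
      then show "k = \<pi> i"
        using * k i unfolding act_def by blast
    qed
  next
    assume "\<forall>k. r (\<pi> i) k \<longrightarrow> k = \<pi> i"
    then show "\<forall>k. act n \<pi> r i k \<longrightarrow> k = i"
      using i inj_onD[OF bij_betw_imp_inj_on[OF bij]] unfolding act_def by blast
  qed
  have nbr: "\<pi> j = cprev n (\<pi> i) \<or> \<pi> j = cnext n (\<pi> i) \<longleftrightarrow> j = cprev n i \<or> j = cnext n i"
    if "i \<in> {1..n}" "j \<in> {1..n}" for i j
    using \<pi> that unfolding nc_symmetry_def by blast
  have "(i, j) \<in> flags n (act n \<pi> r) (act n \<pi> s) \<longleftrightarrow> i \<in> {1..n} \<and> j \<in> {1..n} \<and> (\<pi> i, \<pi> j) \<in> flags n r s"
    for i j
  proof (cases "i \<in> {1..n} \<and> j \<in> {1..n}")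
    case True
    then show ?thesis
      unfolding flags_def mem_Collect_eq prod.case single[OF conjunct1[OF True]]
        nbr[OF conjunct1[OF True] conjunct2[OF True]] by (simp add: act_def)
  next
    case False
    then show ?thesis
      by (auto simp: flags_def act_def)
  qed
  then show ?thesis
    by auto
qed

lemma act_eqtop: "bij_betw \<pi> {1..n} {1..n} \<Longrightarrow> act n \<pi> (eqtop n) = eqtop n"
  by (intro ext) (auto simp: act_def eqtop_def dest: bij_betwE)

lemma act_eqbot: "bij_betw \<pi> {1..n} {1..n} \<Longrightarrow> act n \<pi> (eqbot n) = eqbot n"
  by (intro ext) (auto simp: act_def eqbot_def bij_betw_def dest: inj_onD)

text \<open>Restricted to 2-steps, for which \<open>unseparated\<close> holds automatically and need
  not be transported.\<close>

lemma walk_act: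
  assumes \<pi>: "nc_symmetry n \<pi>" and "walk n ks r V" "set ks \<subseteq> {2}"
  shows "walk n ks (act n \<pi> r) {(i, j). i \<in> {1..n} \<and> j \<in> {1..n} \<and> (\<pi> i, \<pi> j) \<in> V}"
  using assms(2,3)
proof induction
  case walk_top
  then show ?case
    using \<pi> walk.walk_top[of n] by (simp add: nc_symmetry_def act_eqtop)
next
  case (walk_merge r X k ks V)
  have bij: "bij_betw \<pi> {1..n} {1..n}"
    using \<pi> by (simp add: nc_symmetry_def)
  define X' where "X' = {x \<in> {1..n}. \<pi> x \<in> X}"
  have act: "act n \<pi> (merge X r) = merge X' (act n \<pi> r)"
    using act_merge[OF bij walk_merge.hyps(2)] by (simp add: X'_def)
  have "\<pi> ` X' = \<pi> ` {1..n} \<inter> X"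
    unfolding X'_def by blast
  then have "X = \<pi> ` X'"
    using walk_merge.hyps(2) by (simp only: bij_betw_imp_surj_on[OF bij] Int_absorb1)
  moreover have inj: "inj_on \<pi> X'"
    using bij_betw_imp_inj_on[OF bij] by (rule inj_on_subset) (auto simp: X'_def)
  ultimately have card: "card X' = k"
    using walk_merge.hyps(3) by (simp add: card_image)
  have dist: "x = y" if "x \<in> X'" "y \<in> X'" "act n \<pi> r x y" for x y
    using that walk_merge.hyps(5)[of "\<pi> x" "\<pi> y"] inj_onD[OF inj] by (auto simp: X'_def act_def)
  have nc: "nceq n (act n \<pi> r)" "nceq n (merge X' (act n \<pi> r))"
    using \<pi> walk_merge.hyps(1,6) act[symmetric] by (auto simp: nc_symmetry_def)
  have V: "flags n (act n \<pi> r) (merge X' (act n \<pi> r)) \<union> {(i, j). i \<in> {1..n} \<and> j \<in> {1..n} \<and> (\<pi> i, \<pi> j) \<in> V} =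
      {(i, j). i \<in> {1..n} \<and> j \<in> {1..n} \<and> (\<pi> i, \<pi> j) \<in> flags n r (merge X r) \<union> V}"
    unfolding flags_act[OF \<pi> walk_merge.hyps(1), of "merge X r", unfolded act] by blast
  have "X' \<subseteq> {1..n}"
    by (auto simp: X'_def)
  moreover have "unseparated (act n \<pi> r) X'"
    using unseparated_pair card walk_merge.prems by simp
  moreover have "walk n ks (merge X' (act n \<pi> r)) {(i, j). i \<in> {1..n} \<and> j \<in> {1..n} \<and> (\<pi> i, \<pi> j) \<in> V}"
    using walk_merge.IH[unfolded act] walk_merge.prems by simp
  ultimately show ?case
    using walk.walk_merge[OF nc(1) _ card walk_merge.hyps(4) dist nc(2)] unfolding V[symmetric] by blast
qed

lemma nceq_actI:
  assumes r: "nceq n r" and \<pi>: "\<And>i. i \<in> {1..n} \<Longrightarrow> \<pi> i \<in> {1..n}"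
    and nc: "\<And>a b c d. 1 \<le> a \<Longrightarrow> a < b \<Longrightarrow> b < c \<Longrightarrow> c < d \<Longrightarrow> d \<le> n \<Longrightarrow>
      r (\<pi> a) (\<pi> c) \<Longrightarrow> r (\<pi> b) (\<pi> d) \<Longrightarrow> r (\<pi> a) (\<pi> b)"
  shows "nceq n (act n \<pi> r)"
  unfolding nceq_def
proof (intro conjI allI impI ballI)
  show "act n \<pi> r i k" if "act n \<pi> r i j" "act n \<pi> r j k" for i j k
    using that nceq_trans[OF r] unfolding act_def by metis
  show "act n \<pi> r j i" if "act n \<pi> r i j" for i j
    using that nceq_sym[OF r] unfolding act_def by metis
  show "act n \<pi> r a b" if "a < b" "b < c" "c < d" "act n \<pi> r a c" "act n \<pi> r b d" for a b c d
    using that nc[of a b c d] unfolding act_def by simp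
qed (use \<pi> nceq_refl[OF r] in \<open>auto simp: act_def\<close>)

lemma rotation_symmetry: "nc_symmetry 7 (cnext 7)"
  unfolding nc_symmetry_def
proof (intro conjI allI impI)
  have D: "{1..7} = {1, 2, 3, 4, 5, 6, 7::nat}"
    by auto
  show "bij_betw (cnext 7) {1..7} {1..7}"
    unfolding D by (auto simp: bij_betw_def cnext_def)
  show "\<forall>i\<in>{1..7}. \<forall>j\<in>{1..7}. cnext 7 j = cprev 7 (cnext 7 i) \<or> cnext 7 j = cnext 7 (cnext 7 i) \<longleftrightarrow>
      j = cprev 7 i \<or> j = cnext 7 i"
    unfolding D by (simp add: cnext_def cprev_def)
  fix r
  assume r: "nceq 7 r"
  show "nceq 7 (act 7 (cnext 7) r)"
  proof (rule nceq_actI[OF r])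
    fix a b c d :: nat
    assume abcd: "1 \<le> a" "a < b" "b < c" "c < d" "d \<le> 7"
      and rr: "r (cnext 7 a) (cnext 7 c)" "r (cnext 7 b) (cnext 7 d)"
    have nx: "cnext 7 a = Suc a" "cnext 7 b = Suc b" "cnext 7 c = Suc c"
      using abcd by (auto simp: cnext_def)
    note rr = rr[unfolded nx]
    have "r (Suc a) (Suc b)"
    \<comment> \<open>The point 7 moves to 1 and becomes the smallest of the four, so the
      noncrossing law is applied to the rotated order.\<close>
    proof (cases "d = 7")
      case True
      then have "r 1 (Suc b)"
        using rr(2) nceq_sym[OF r] by (simp add: cnext_def)
      then have "r 1 (Suc a)"
        using nceq_noncrossing[OF r _ _ _ _ rr(1), of 1 "Suc b"] abcd by simp
      with \<open>r 1 (Suc b)\<close> show ?thesis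
        using nceq_trans[OF r] nceq_sym[OF r] by metis
    next
      case False
      then have "cnext 7 d = Suc d"
        by (simp add: cnext_def)
      then show ?thesis
        using nceq_noncrossing[OF r _ _ _ rr] abcd by simp
    qed
    then show "r (cnext 7 a) (cnext 7 b)"
      by (simp only: nx)
  qed (auto simp: cnext_def)
qed

lemma reflection_symmetry: "nc_symmetry 7 (\<lambda>i. 8 - i)"
  unfolding nc_symmetry_def
proof (intro conjI allI impI)
  have D: "{1..7} = {1, 2, 3, 4, 5, 6, 7::nat}"
    by auto
  show "bij_betw (\<lambda>i. 8 - i) {1..7} {1..7::nat}"
    unfolding D by (auto simp: bij_betw_def)
  show "\<forall>i\<in>{1..7}. \<forall>j\<in>{1..7}. 8 - j = cprev 7 (8 - i) \<or> 8 - j = cnext 7 (8 - i) \<longleftrightarrow>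
      j = cprev 7 i \<or> j = cnext 7 i"
    unfolding D by (simp add: cnext_def cprev_def)
  fix r
  assume r: "nceq 7 r"
  show "nceq 7 (act 7 (\<lambda>i. 8 - i) r)"
  proof (rule nceq_actI[OF r])
    fix a b c d :: nat
    assume abcd: "1 \<le> a" "a < b" "b < c" "c < d" "d \<le> 7"
      and rr: "r (8 - a) (8 - c)" "r (8 - b) (8 - d)"
    have "r (8 - d) (8 - c)"
      using nceq_noncrossing[OF r, of "8 - d" "8 - c" "8 - b" "8 - a"] abcd rr nceq_sym[OF r] by simp
    then show "r (8 - a) (8 - b)"
      using rr nceq_trans[OF r] nceq_sym[OF r] by metis
  qed auto
qed

section \<open>Sets of flags met by every walk of 2-steps\<close>

definition blocking :: "(nat \<times> nat) set \<Rightarrow> bool" where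
  "blocking T \<longleftrightarrow> (\<forall>V. walk 7 (replicate 6 2) (eqbot 7) V \<longrightarrow> V \<inter> T \<noteq> {})"

lemma blocking_mono: "blocking T \<Longrightarrow> T \<subseteq> U \<Longrightarrow> blocking U"
  unfolding blocking_def by blast

text \<open>A walk avoiding the image would pull back along \<open>\<pi>\<close> to a walk avoiding
  \<open>T\<close>.\<close>

lemma blocking_image:
  assumes \<pi>: "nc_symmetry 7 \<pi>" and T: "blocking T"
  shows "blocking (map_prod \<pi> \<pi> ` T)"
  unfolding blocking_def
proof (intro allI impI)
  fix V
  assume "walk 7 (replicate 6 2) (eqbot 7) V"
  from walk_act[OF \<pi> this] \<pi>
  have "walk 7 (replicate 6 2) (eqbot 7) {(i, j). i \<in> {1..7} \<and> j \<in> {1..7} \<and> (\<pi> i, \<pi> j) \<in> V}"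
    by (simp add: nc_symmetry_def act_eqbot)
  then have "{(i, j). i \<in> {1..7} \<and> j \<in> {1..7} \<and> (\<pi> i, \<pi> j) \<in> V} \<inter> T \<noteq> {}"
    using T unfolding blocking_def by blast
  then show "V \<inter> map_prod \<pi> \<pi> ` T \<noteq> {}"
    by force
qed

subsection \<open>Exhaustive search\<close>

text \<open>Runs through all choices of \<open>k\<close> entries and demands \<open>f\<close> at
  every leaf; \<open>cs\<close> holds the entries chosen and \<open>rest\<close> those passed over.
  No list of subsets is ever built.\<close>

fun each_pick :: "('a list \<Rightarrow> 'a list \<Rightarrow> bool) \<Rightarrow> nat \<Rightarrow> 'a list \<Rightarrow> 'a list \<Rightarrow> 'a list \<Rightarrow> bool" where
  "each_pick f 0 cs rest bs = f cs (rest @ bs)"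
| "each_pick f (Suc k) cs rest [] = True"
| "each_pick f (Suc k) cs rest (b # bs) =
     (if each_pick f k (b # cs) rest bs then each_pick f (Suc k) cs (b # rest) bs else False)"

text \<open>Choosing exactly the entries in \<open>Y\<close> leads to one leaf. The accumulators
  reverse the order of entries, hence only a set and multisets are specified.\<close>

lemma each_pick_subset:
  "each_pick f k cs rest bs \<Longrightarrow> distinct bs \<Longrightarrow> Y \<subseteq> set bs \<Longrightarrow> card Y = k \<Longrightarrow>
    \<exists>ds es. f (ds @ cs) es \<and> set ds = Y \<and> mset ds + mset es = mset rest + mset bs"
proof (induction f k cs rest bs arbitrary: Y rule: each_pick.induct)
  case (1 f cs rest bs)
  then have "Y = {}"
    using finite_subset[of Y "set bs"] by simp
  then show ?case
    using 1 by (intro exI[of _ "[]"] exI[of _ "rest @ bs"]) simp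
next
  case (2 f k cs rest)
  then show ?case
    by simp
next
  case (3 f k cs rest b bs)
  show ?case
  proof (cases "b \<in> Y")
    case True
    have "each_pick f k (b # cs) rest bs"
      using "3.prems"(1) by (simp split: if_splits)
    moreover have "Y - {b} \<subseteq> set bs" "card (Y - {b}) = k"
      using "3.prems" True by auto
    ultimately obtain ds es where ds: "f (ds @ b # cs) es" "set ds = Y - {b}"
      "mset ds + mset es = mset rest + mset bs"
      using "3.IH"(1)[of "Y - {b}"] "3.prems"(2) by auto
    have "f ((ds @ [b]) @ cs) es" "set (ds @ [b]) = Y"
      "mset (ds @ [b]) + mset es = mset rest + mset (b # bs)"
      using ds True by auto
    then show ?thesis
      by blast
  next
    case False
    have "each_pick f k (b # cs) rest bs" "each_pick f (Suc k) cs (b # rest) bs"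
      using "3.prems"(1) by (simp_all split: if_splits)
    moreover have "Y \<subseteq> set bs"
      using "3.prems" False by auto
    ultimately obtain ds es where "f (ds @ cs) es" "set ds = Y" "mset ds + mset es = mset (b # rest) + mset bs"
      using "3.IH"(2)[of Y] "3.prems"(2,4) by auto
    then show ?thesis
      by (intro exI[of _ ds] exI[of _ es]) simp
  qed
qed

lemma each_pick_True: "(\<And>ds es. f ds es) \<Longrightarrow> each_pick f k cs rest bs"
  by (induction f k cs rest bs rule: each_pick.induct) auto

definition repr :: "nat \<Rightarrow> nat list list \<Rightarrow> (nat \<Rightarrow> nat \<Rightarrow> bool) \<Rightarrow> bool" where
  "repr n bs r \<longleftrightarrow> distinct (concat bs) \<and> set (concat bs) = {1..n} \<and> [] \<notin> set bs \<and>
     (\<forall>i j. r i j \<longleftrightarrow> (\<exists>b\<in>set bs. i \<in> set b \<and> j \<in> set b))"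

text \<open>
  One representative \<open>x\<close>, \<open>y\<close> of each block suffices below: the tests only have to reject merges that
  really cross, and every merge they let through merely enlarges the search.
\<close>

fun separates :: "nat \<Rightarrow> nat \<Rightarrow> nat list \<Rightarrow> bool" where
  "separates x y [] = False"
| "separates x y [t] = False"
| "separates x y (t # u # ts) =
     (if between x y t then \<not> list_all (between x y) (u # ts) else list_ex (between x y) (u # ts))"

fun crosses :: "nat \<Rightarrow> nat list list \<Rightarrow> nat list list \<Rightarrow> bool" where
  "crosses x [] es = False"
| "crosses x (d # ds) es = (if list_ex (separates x (hd d)) es then True else crosses x ds es)"

text \<open>\<open>cs\<close> collects the blocks already passed, so \<open>cs @ ds\<close> are the
  blocks to be joined other than \<open>d\<close>.\<close>

fun entangled :: "nat list list \<Rightarrow> nat list list \<Rightarrow> bool" where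
  "entangled cs [] = False"
| "entangled cs (d # ds) =
     (if crosses (hd (hd (cs @ ds))) (tl (cs @ ds)) [d] then True else entangled (d # cs) ds)"

fun new_flags :: "nat list \<Rightarrow> nat list list \<Rightarrow> (nat \<times> nat) list" where
  "new_flags u [] = []"
| "new_flags u (d # ds) =
     (case d of [i] \<Rightarrow> map (Pair i) (filter (List.member u) [cprev 7 i, cnext 7 i]) @ new_flags u ds
      | _ \<Rightarrow> new_flags u ds)"

lemma repr_distinct: "repr n bs r \<Longrightarrow> distinct bs"
  unfolding repr_def distinct_concat_iff by (metis removeAll_id)

lemma repr_unique:
  assumes "repr n bs r" "b \<in> set bs" "c \<in> set bs" "i \<in> set b" "i \<in> set c"
  shows "b = c"
proof (rule ccontr)
  assume "b \<noteq> c"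
  then have "set b \<inter> set c = {}"
    using assms(1-3) by (simp add: repr_def distinct_concat_iff)
  then show False
    using assms(4,5) by blast
qed

lemma repr_iff: "repr n bs r \<Longrightarrow> r i j \<longleftrightarrow> (\<exists>b\<in>set bs. i \<in> set b \<and> j \<in> set b)"
  unfolding repr_def by metis

lemma repr_block:
  assumes "repr n bs r" "b \<in> set bs" "i \<in> set b"
  shows "r i j \<longleftrightarrow> j \<in> set b"
  unfolding repr_iff[OF assms(1)] using repr_unique[OF assms(1,2) _ assms(3)] assms(2,3) by blast

lemma repr_set: "repr n bs r \<Longrightarrow> i \<in> {1..n} \<longleftrightarrow> (\<exists>b\<in>set bs. i \<in> set b)"
  unfolding repr_def set_concat by (metis UN_iff)

lemma repr_merge:
  assumes bs: "repr n bs r" and X: "X \<subseteq> {1..n}" "X \<noteq> {}"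
    and ds: "set ds = {b \<in> set bs. \<exists>x\<in>X. x \<in> set b}" and m: "mset ds + mset es = mset bs"
  shows "repr n (concat ds # es) (merge X r)"
proof -
  have perm: "mset (ds @ es) = mset bs"
    using m by simp
  then have "mset (concat (ds @ es)) = mset (concat bs)"
    unfolding mset_concat by (metis mset_map sum_mset_sum_list)
  from mset_eq_imp_distinct_iff[OF this] mset_eq_setD[OF this]
  have c: "distinct (concat (concat ds # es))" "set (concat (concat ds # es)) = {1..n}"
    using bs unfolding repr_def by (simp_all only: concat.simps concat_append)
  have st: "set ds \<union> set es = set bs"
    using perm by (metis mset_eq_setD set_append)
  have "concat ds \<noteq> []"
  proof -
    obtain x where "x \<in> X"
      using X by blast
    then obtain b where "b \<in> set ds" "x \<in> set b"
      using repr_set[OF bs, of x] X(1) unfolding ds by blast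
    then have "x \<in> set (concat ds)"
      by auto
    then show ?thesis
      by (metis empty_iff list.set(1))
  qed
  then have ne: "[] \<notin> set (concat ds # es)"
    using bs st by (auto simp: repr_def)
  have inX: "(\<exists>x\<in>X. r i x) \<longleftrightarrow> i \<in> set (concat ds)" for i
    unfolding set_concat ds repr_iff[OF bs] by blast
  have "merge X r i j \<longleftrightarrow> (\<exists>b\<in>set (concat ds # es). i \<in> set b \<and> j \<in> set b)" for i j
  proof -
    have "r i j \<longleftrightarrow> (\<exists>b\<in>set ds. i \<in> set b \<and> j \<in> set b) \<or> (\<exists>b\<in>set es. i \<in> set b \<and> j \<in> set b)"
      unfolding repr_iff[OF bs] st[symmetric] by blast
    then show ?thesis
      unfolding merge_def inX by auto
  qed
  then show ?thesis
    unfolding repr_def using c ne by blast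
qed

lemma repr_transversal:
  assumes bs: "repr n bs r" and X: "X \<subseteq> {1..n}" "\<And>x y. x \<in> X \<Longrightarrow> y \<in> X \<Longrightarrow> r x y \<Longrightarrow> x = y"
  shows "card {b \<in> set bs. \<exists>x\<in>X. x \<in> set b} = card X"
proof -
  have "\<exists>b\<in>set bs. x \<in> set b" if "x \<in> X" for x
    using that X(1) repr_set[OF bs, of x] by blast
  then obtain f where f: "\<And>x. x \<in> X \<Longrightarrow> f x \<in> set bs \<and> x \<in> set (f x)"
    by metis
  have "b = f x" if "x \<in> X" "b \<in> set bs" "x \<in> set b" for x b
    using repr_unique[OF bs that(2) _ that(3)] f[OF that(1)] by blast
  then have "{b \<in> set bs. \<exists>x\<in>X. x \<in> set b} = f ` X"
    using f by (intro equalityI subsetI) auto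
  moreover have "inj_on f X"
  proof (rule inj_onI)
    fix x y
    assume xy: "x \<in> X" "y \<in> X" "f x = f y"
    then have "r x y"
      using repr_block[OF bs, of "f x" x y] f[of x] f[of y] by simp
    then show "x = y"
      using X(2) xy by blast
  qed
  ultimately show ?thesis
    by (simp add: card_image)
qed

lemma separates_iff:
  "separates x y ts \<longleftrightarrow> (\<exists>t\<in>set ts. between x y t) \<and> (\<exists>t\<in>set ts. \<not> between x y t)"
  by (induction x y ts rule: separates.induct) (auto simp: list_all_iff list_ex_iff)

lemma crosses_iff: "crosses x ds es \<longleftrightarrow> (\<exists>d\<in>set ds. \<exists>e\<in>set es. separates x (hd d) e)"
  by (induction x ds es rule: crosses.induct) (auto simp: list_ex_iff)

text \<open>Soundness of the pruning: the tested chord has both ends in the new class, so by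
  \<open>same_side\<close> it cannot separate a remaining block.\<close>

lemma repr_not_crosses:
  assumes bs: "repr n (concat ds # es) r" and r: "nceq n r" and ne: "ds \<noteq> []" "[] \<notin> set ds"
  shows "\<not> crosses (hd (hd ds)) (tl ds) es"
proof
  assume "crosses (hd (hd ds)) (tl ds) es"
  then obtain d e t u where d: "d \<in> set (tl ds)" and e: "e \<in> set es" and tu: "t \<in> set e" "u \<in> set e"
    "between (hd (hd ds)) (hd d) t" "\<not> between (hd (hd ds)) (hd d) u"
    unfolding crosses_iff separates_iff by blast
  have "d \<in> set ds" "hd ds \<in> set ds"
    using d ne(1) by (auto dest: list.set_sel(2))
  then have x: "hd (hd ds) \<in> set (concat ds)" "hd d \<in> set (concat ds)"
    using ne(2) by (metis UN_I hd_in_set set_concat)+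
  have "r (hd (hd ds)) (hd d)" "r t u"
    using repr_block[OF bs _ x(1)] x(2) repr_block[OF bs _ tu(1)] tu(2) e by auto
  moreover have "\<not> r (hd (hd ds)) t"
  proof
    assume "r (hd (hd ds)) t"
    then have "t \<in> set (concat ds)"
      using repr_block[OF bs _ x(1)] by simp
    then show False
      using bs e tu(1) by (auto simp: repr_def)
  qed
  ultimately show False
    using same_side[OF r] tu(3,4) by blast
qed

lemma repr_not_entangled:
  assumes bs: "repr n bs r" and X: "unseparated r X"
  shows "distinct (cs @ ds) \<Longrightarrow> set (cs @ ds) \<subseteq> {b \<in> set bs. \<exists>x\<in>X. x \<in> set b} \<Longrightarrow> \<not> entangled cs ds"
proof (induction cs ds rule: entangled.induct)
  case (2 cs d ds)
  have "\<not> crosses (hd (hd (cs @ ds))) (tl (cs @ ds)) [d]"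
  proof
    assume "crosses (hd (hd (cs @ ds))) (tl (cs @ ds)) [d]"
    then obtain e t u where e: "e \<in> set (tl (cs @ ds))" and tu: "t \<in> set d" "u \<in> set d"
      "between (hd (hd (cs @ ds))) (hd e) t \<noteq> between (hd (hd (cs @ ds))) (hd e) u"
      unfolding crosses_iff separates_iff by auto
    define f where "f = hd (cs @ ds)"
    obtain es where es: "cs @ ds = f # es" "e \<in> set es"
      using e by (cases "cs @ ds") (auto simp: f_def)
    have "e \<in> set (cs @ ds)" "f \<in> set (cs @ ds)"
      unfolding es(1) using es(2) by auto
    moreover have "distinct (f # es)" "d \<notin> set (f # es)"
      using "2.prems"(1) unfolding es(1)[symmetric] by auto
    ultimately have ne: "d \<noteq> f" "d \<noteq> e" "f \<noteq> e" and "f \<in> set (cs @ d # ds)" "e \<in> set (cs @ d # ds)"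
      using es(2) by auto
    then have in_bs: "d \<in> set bs" "f \<in> set bs" "e \<in> set bs"
      and "\<exists>x\<in>X. x \<in> set d" "\<exists>x\<in>X. x \<in> set f" "\<exists>x\<in>X. x \<in> set e"
      using "2.prems"(2) by auto
    then obtain x y z where xyz: "x \<in> X" "y \<in> X" "z \<in> X" "x \<in> set d" "y \<in> set f" "z \<in> set e"
      by blast
    have "x \<noteq> y" "x \<noteq> z" "y \<noteq> z"
      using xyz ne repr_unique[OF bs] in_bs by blast+
    moreover have "hd f \<in> set f" "hd e \<in> set e"
      using xyz by (auto intro: hd_in_set)
    then have "r x t" "r x u" "r y (hd f)" "r z (hd e)"
      using tu(1,2) xyz repr_block[OF bs in_bs(1) xyz(4)] repr_block[OF bs in_bs(2) xyz(5)]
        repr_block[OF bs in_bs(3) xyz(6)] by auto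
    ultimately show False
      using X xyz(1-3) tu(3) unfolding unseparated_def f_def by blast
  qed
  moreover have "\<not> entangled (d # cs) ds"
    using "2.IH" calculation "2.prems" by simp
  ultimately show ?case
    by simp
qed simp

lemma new_flags_subset:
  "set (new_flags u ds) \<subseteq> {(i, j). [i] \<in> set ds \<and> j \<in> set u \<and> (j = cprev 7 i \<or> j = cnext 7 i)}"
  by (induction u ds rule: new_flags.induct) (auto split: list.splits)

lemma repr_new_flags:
  assumes bs: "repr 7 bs r" and bs': "repr 7 (concat ds # es) s" and ds: "set ds \<subseteq> set bs"
  shows "set (new_flags (concat ds) ds) \<subseteq> flags 7 r s"
proof -
  have "(i, j) \<in> flags 7 r s"
    if ij: "[i] \<in> set ds" "j \<in> set (concat ds)" "j = cprev 7 i \<or> j = cnext 7 i" for i j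
  proof -
    have "\<forall>k. r i k \<longrightarrow> k = i"
      using repr_block[OF bs, of "[i]" i] ds ij(1) by auto
    moreover have "i \<in> set (concat ds)"
      using ij(1) by force
    then have "s i j"
      using repr_block[OF bs', of "concat ds" i j] ij(2) by simp
    ultimately show ?thesis
      using ij(3) by (simp add: flags_def)
  qed
  then show ?thesis
    using new_flags_subset[of "concat ds" ds] by blast
qed

text \<open>The link from walks to search: the blocks met by \<open>X\<close> form one of the
  choices, this choice survives both pruning tests, and the flags computed for it are
  genuine.\<close>

lemma each_pick_merge:
  assumes f: "each_pick f k [] [] bs" and bs: "repr 7 bs r"
    and X: "X \<subseteq> {1..7}" "card X = k" "k > 0" "\<And>x y. x \<in> X \<Longrightarrow> y \<in> X \<Longrightarrow> r x y \<Longrightarrow> x = y"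
    and nc: "nceq 7 (merge X r)" and X': "unseparated r X"
  obtains ds es where "f ds es" "repr 7 (concat ds # es) (merge X r)"
    "length ds = k" "length bs = k + length es"
    "\<not> crosses (hd (hd ds)) (tl ds) es" "\<not> entangled [] ds"
    "set (new_flags (concat ds) ds) \<subseteq> flags 7 r (merge X r)"
proof -
  obtain ds es where ds: "f ds es" "set ds = {b \<in> set bs. \<exists>x\<in>X. x \<in> set b}"
    "mset ds + mset es = mset bs"
    using each_pick_subset[OF f repr_distinct[OF bs], of "{b \<in> set bs. \<exists>x\<in>X. x \<in> set b}"]
      repr_transversal[OF bs X(1,4)] X(2) by auto
  have ne: "X \<noteq> {}"
    using X(2,3) by auto
  have rep: "repr 7 (concat ds # es) (merge X r)"
    using repr_merge[OF bs X(1) ne ds(2,3)] .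
  have "distinct ds"
    using repr_distinct[OF bs] ds(3) by (metis distinct_append mset_append mset_eq_imp_distinct_iff)
  then have len: "length ds = k"
    using repr_transversal[OF bs X(1,4)] X(2) ds(2) by (metis distinct_card)
  have "length bs = k + length es"
    using arg_cong[OF ds(3), of size] len by simp
  moreover have "\<not> crosses (hd (hd ds)) (tl ds) es"
    by (rule repr_not_crosses[OF rep nc]) (use len X(3) bs ds(2) in \<open>auto simp: repr_def\<close>)
  moreover have "\<not> entangled [] ds"
    by (rule repr_not_entangled[OF bs X']) (use \<open>distinct ds\<close> ds(2) in auto)
  moreover have "set (new_flags (concat ds) ds) \<subseteq> flags 7 r (merge X r)"
    by (rule repr_new_flags[OF bs rep]) (use ds(2) in auto)
  ultimately show thesis
    using that ds(1) rep len by blast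
qed

text \<open>A step of size \<open>k\<close> replaces \<open>k\<close> blocks by one, and the top
  relation has a single block.\<close>

lemma walk_length:
  "walk 7 ks r V \<Longrightarrow> repr 7 bs r \<Longrightarrow> length bs + length ks = Suc (sum_list ks)"
proof (induction arbitrary: bs rule: walk.induct)
  case walk_top
  obtain b where b: "b \<in> set bs" "1 \<in> set b"
    using repr_set[OF walk_top, of 1] by auto
  have "c = b" if c: "c \<in> set bs" for c
  proof -
    have "c \<noteq> []"
      using c walk_top by (auto simp: repr_def)
    then have i: "hd c \<in> set c"
      by simp
    then have "eqtop 7 1 (hd c)"
      using repr_set[OF walk_top, of "hd c"] c by (auto simp: eqtop_def)
    then have "hd c \<in> set b"
      using repr_block[OF walk_top b] by simp
    then show ?thesis
      using repr_unique[OF walk_top c b(1) i] by simp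
  qed
  then have "set bs = {b}"
    using b by blast
  then show ?case
    using distinct_card[OF repr_distinct[OF walk_top]] by simp
next
  case (walk_merge r X k ks V)
  \<comment> \<open>A search with the constantly true continuation always succeeds; it serves to
    supply the list of blocks after the step.\<close>
  from each_pick_merge[OF each_pick_True[OF TrueI] walk_merge.prems walk_merge.hyps(2-7)]
  obtain ds es :: "nat list list" where "repr 7 (concat ds # es) (merge X r)" "length bs = k + length es" .
  then show ?case
    using walk_merge.IH[of "concat ds # es"] by simp
qed

section \<open>The two searches and their soundness\<close>

fun flag_in :: "(nat \<times> nat) list \<Rightarrow> nat \<times> nat \<Rightarrow> bool" where
  "flag_in [] p = False"
| "flag_in ((i, j) # fs) (x, y) = (if x = i then if y = j then True else flag_in fs (x, y) else flag_in fs (x, y))"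

lemma flag_in_iff: "flag_in fs p \<longleftrightarrow> p \<in> set fs"
  by (induction fs p rule: flag_in.induct) auto

definition hit_step :: "(nat list list \<Rightarrow> bool) \<Rightarrow> (nat \<times> nat) list \<Rightarrow> nat list list \<Rightarrow> nat list list \<Rightarrow> bool" where
  "hit_step h S ds es = (if crosses (hd (hd ds)) (tl ds) es then True
     else if list_ex (flag_in S) (new_flags (concat ds) ds) then True else h (concat ds # es))"

text \<open>A branch is settled once it gains a flag of \<open>S\<close>; reaching the end without
  one is a failure, hence \<open>False\<close> for the empty list.\<close>

primrec hits :: "nat list \<Rightarrow> (nat \<times> nat) list \<Rightarrow> nat list list \<Rightarrow> bool" where
  "hits [] S bs = False"
| "hits (k # ks) S bs = each_pick (hit_step (hits ks S) S) k [] [] bs"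

lemma hits_walk:
  "walk 7 ks r V \<Longrightarrow> repr 7 bs r \<Longrightarrow> hits ks S bs \<Longrightarrow> V \<inter> set S \<noteq> {}"
proof (induction arbitrary: bs rule: walk.induct)
  case walk_top
  then show ?case
    by simp
next
  case (walk_merge r X k ks V)
  have "each_pick (hit_step (hits ks S) S) k [] [] bs"
    using walk_merge.prems(2) by simp
  from each_pick_merge[OF this walk_merge.prems(1) walk_merge.hyps(2-7)]
  obtain ds es where ds: "hit_step (hits ks S) S ds es" "repr 7 (concat ds # es) (merge X r)"
    "\<not> crosses (hd (hd ds)) (tl ds) es" "set (new_flags (concat ds) ds) \<subseteq> flags 7 r (merge X r)" .
  show ?case
  proof (cases "list_ex (flag_in S) (new_flags (concat ds) ds)")
    case True
    then show ?thesis
      using ds(4) by (auto simp: list_ex_iff flag_in_iff)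
  next
    case False
    then have "V \<inter> set S \<noteq> {}"
      using walk_merge.IH[OF ds(2)] ds(1,3) by (simp add: hit_step_def)
    then show ?thesis
      by blast
  qed
qed

definition collect_step ::
  "((nat \<times> nat) list \<Rightarrow> nat list list \<Rightarrow> bool) \<Rightarrow> (nat \<times> nat) list \<Rightarrow> nat list list \<Rightarrow> nat list list \<Rightarrow> bool" where
  "collect_step h fs ds es = (if crosses (hd (hd ds)) (tl ds) es then True
     else if entangled [] ds then True else h (new_flags (concat ds) ds @ fs) (concat ds # es))"

text \<open>Flags are accumulated and judged only at the end, since it is not known in advance which
  pattern the walk will contain.\<close>

primrec collects :: "((nat \<times> nat) list \<Rightarrow> bool) \<Rightarrow> nat list \<Rightarrow> (nat \<times> nat) list \<Rightarrow> nat list list \<Rightarrow> bool" where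
  "collects P [] fs bs = P fs"
| "collects P (k # ks) fs bs = each_pick (collect_step (collects P ks) fs) k [] [] bs"

lemma collects_walk:
  "walk 7 ks r V \<Longrightarrow> repr 7 bs r \<Longrightarrow> collects P ks fs bs \<Longrightarrow> \<exists>gs. P gs \<and> set gs \<subseteq> set fs \<union> V"
proof (induction arbitrary: bs fs rule: walk.induct)
  case walk_top
  then show ?case
    by auto
next
  case (walk_merge r X k ks V)
  have "each_pick (collect_step (collects P ks) fs) k [] [] bs"
    using walk_merge.prems(2) by simp
  from each_pick_merge[OF this walk_merge.prems(1) walk_merge.hyps(2-7)]
  obtain ds es where ds: "collect_step (collects P ks) fs ds es" "repr 7 (concat ds # es) (merge X r)"
    "\<not> crosses (hd (hd ds)) (tl ds) es" "\<not> entangled [] ds" "set (new_flags (concat ds) ds) \<subseteq> flags 7 r (merge X r)" .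
  then have "collects P ks (new_flags (concat ds) ds @ fs) (concat ds # es)"
    by (simp add: collect_step_def)
  from walk_merge.IH[OF ds(2) this] show ?case
    using ds(5) by fastforce
qed

definition singletons :: "nat list list" where
  "singletons = [[1], [2], [3], [4], [5], [6], [7]]"

lemma repr_singletons: "repr 7 singletons (eqbot 7)"
proof -
  have "{1..7} = {1, 2, 3, 4, 5, 6, 7::nat}"
    by auto
  then show ?thesis
    unfolding repr_def singletons_def eqbot_def by auto
qed

text \<open>
  Listed in cyclic order, so that a rotation of the circle shifts this list by two places and the
  reflection \<open>8 - i\<close> reverses it.
\<close>

definition all_flags :: "(nat \<times> nat) list" where
  "all_flags = [(1, 7), (1, 2), (2, 1), (2, 3), (3, 2), (3, 4), (4, 3), (4, 5), (5, 4), (5, 6), (6, 5), (6, 7), (7, 6), (7, 1)]"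

definition decode :: "bool list \<Rightarrow> (nat \<times> nat) list" where
  "decode p = map fst (filter snd (zip all_flags p))"

text \<open>Nothing is presupposed about the rows: \<open>patterns_block\<close> verifies that every
  walk of 2-steps hits each of them, and the four \<open>collects\<close> evaluations that, up to
  symmetry, they suffice.\<close>

definition patterns :: "bool list list" where
  "patterns =
    [[False, True, True, False, False, True, True, True, True, True, True, False, False, True],
     [True, True, False, False, False, True, True, True, True, True, True, False, False, False],
     [True, False, True, True, False, False, True, True, True, True, True, True, False, False],
     [False, True, True, False, False, False, True, True, True, True, True, True, False, False],
     [True, False, False, False, True, True, False, True, True, True, True, False, False, True],
     [False, True, False, True, False, True, True, False, True, True, True, False, True, True],
     [True, False, False, True, False, True, True, False, True, True, True, False, False, True],
     [True, True, False, False, False, True, True, False, True, True, True, True, False, False],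
     [False, True, False, False, True, True, False, False, True, True, True, False, True, True],
     [True, True, False, True, True, False, True, True, False, True, True, False, True, False],
     [True, False, False, True, True, False, True, True, False, True, True, False, False, True],
     [False, False, True, True, False, False, True, True, False, True, True, False, True, True],
     [True, True, False, False, True, True, False, True, False, True, True, False, True, False],
     [True, False, True, False, True, True, False, True, False, True, True, False, False, True]]"

definition blocks_all :: "bool list \<Rightarrow> bool" where
  "blocks_all p = hits (replicate 6 2) (decode p) singletons"

fun included :: "bool list \<Rightarrow> bool list \<Rightarrow> bool" where
  "included (p # ps) (q # qs) = (if p then (if q then included ps qs else False) else included ps qs)"
| "included ps qs = (ps = [])"

text \<open>
  The disjunction of all rows of \<open>patterns\<close> in the variables of \<open>all_flags\<close>. Every row contains
  \<open>j\<close> and \<open>k\<close>; testing these first by \<open>if\<close> lets the simplifier discard most rotations at once.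
\<close>

definition matches ::
  "bool \<Rightarrow> bool \<Rightarrow> bool \<Rightarrow> bool \<Rightarrow> bool \<Rightarrow> bool \<Rightarrow> bool \<Rightarrow>
    bool \<Rightarrow> bool \<Rightarrow> bool \<Rightarrow> bool \<Rightarrow> bool \<Rightarrow> bool \<Rightarrow> bool \<Rightarrow> bool" where
  "matches a b c d e f g h i j k l m n =
    (if j then if k then
       b \<and> c \<and> f \<and> g \<and> h \<and> i \<and> n \<or>
       a \<and> b \<and> f \<and> g \<and> h \<and> i \<or>
       a \<and> c \<and> d \<and> g \<and> h \<and> i \<and> l \<or>
       b \<and> c \<and> g \<and> h \<and> i \<and> l \<or>
       a \<and> e \<and> f \<and> h \<and> i \<and> n \<or>
       b \<and> d \<and> f \<and> g \<and> i \<and> m \<and> n \<or>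
       a \<and> d \<and> f \<and> g \<and> i \<and> n \<or>
       a \<and> b \<and> f \<and> g \<and> i \<and> l \<or>
       b \<and> e \<and> f \<and> i \<and> m \<and> n \<or>
       a \<and> b \<and> d \<and> e \<and> g \<and> h \<and> m \<or>
       a \<and> d \<and> e \<and> g \<and> h \<and> n \<or>
       c \<and> d \<and> g \<and> h \<and> m \<and> n \<or>
       a \<and> b \<and> e \<and> f \<and> h \<and> m \<or>
       a \<and> c \<and> e \<and> f \<and> h \<and> n
     else False else False)"

primrec rotation_matches where
  "rotation_matches 0 a b c d e f g h i j k l m n = False"
| "rotation_matches (Suc r) a b c d e f g h i j k l m n =
     (if matches a b c d e f g h i j k l m n then True else rotation_matches r c d e f g h i j k l m n a b)"

definition dihedral_matches where
  "dihedral_matches a b c d e f g h i j k l m n =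
     (if rotation_matches 7 a b c d e f g h i j k l m n then True else rotation_matches 7 n m l k j i h g f e d c b a)"

definition pattern_found :: "(nat \<times> nat) list \<Rightarrow> bool" where
  "pattern_found fs = dihedral_matches
    (flag_in fs (1, 7)) (flag_in fs (1, 2)) (flag_in fs (2, 1)) (flag_in fs (2, 3)) (flag_in fs (3, 2))
    (flag_in fs (3, 4)) (flag_in fs (4, 3)) (flag_in fs (4, 5)) (flag_in fs (5, 4)) (flag_in fs (5, 6))
    (flag_in fs (6, 5)) (flag_in fs (6, 7)) (flag_in fs (7, 6)) (flag_in fs (7, 1))"

lemma patterns_block_take: "list_all blocks_all (take 7 patterns)"
  by code_simp

lemma patterns_block_drop: "list_all blocks_all (drop 7 patterns)"
  by code_simp

lemma patterns_block: "list_all blocks_all patterns"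
  using patterns_block_take patterns_block_drop by (metis append_take_drop_id list_all_append)

text \<open>This and the next three evaluations treat the four possible positions of the 4-step
  among three 2-steps.\<close>

lemma collects_4222: "collects pattern_found [4, 2, 2, 2] [] singletons"
  by code_simp

lemma collects_2422: "collects pattern_found [2, 4, 2, 2] [] singletons"
  by code_simp

lemma collects_2242: "collects pattern_found [2, 2, 4, 2] [] singletons"
  by code_simp

lemma collects_2224: "collects pattern_found [2, 2, 2, 4] [] singletons"
  by code_simp

lemma blocking_decode:
  assumes "p \<in> set patterns"
  shows "blocking (set (decode p))"
  using assms patterns_block hits_walk[OF _ repr_singletons]
  unfolding blocking_def blocks_all_def list_all_iff by blast

lemma included_decode:
  "included p q \<Longrightarrow> length p = length q \<Longrightarrow> set (decode p) \<subseteq> set (decode q)"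
proof -
  have "set (map fst (filter snd (zip xs p))) \<subseteq> set (map fst (filter snd (zip xs q)))"
    if "included p q" "length p = length q" for xs :: "(nat \<times> nat) list"
    using that
  proof (induction p q arbitrary: xs rule: included.induct)
    case (1 p ps q qs)
    then show ?case
      by (cases xs) (auto split: if_splits)
  qed auto
  then show "included p q \<Longrightarrow> length p = length q \<Longrightarrow> ?thesis"
    unfolding decode_def by blast
qed

text \<open>Turns a decoded set with symbolic Booleans into a union over all fourteen flags;
  rotating or reflecting it is then a rearrangement of that union.\<close>

definition guarded :: "bool \<Rightarrow> 'a \<Rightarrow> 'a set" where
  "guarded p x = (if p then {x} else {})"

lemma image_guarded: "f ` guarded p x = guarded p (f x)"
  by (simp add: guarded_def)

lemma set_decode_Cons:
  "set (map fst (filter snd (zip (x # xs) (p # ps)))) = guarded p x \<union> set (map fst (filter snd (zip xs ps)))"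
  by (simp add: guarded_def)

lemma set_decode_Nil: "set (map fst (filter snd (zip [] ps))) = {}"
  by simp

lemma cnext_values:
  "cnext 7 1 = 2" "cnext 7 2 = 3" "cnext 7 3 = 4" "cnext 7 4 = 5" "cnext 7 5 = 6" "cnext 7 6 = 7" "cnext 7 7 = 1"
  by (simp_all add: cnext_def)

lemma reflection_values:
  "8 - 1 = (7 :: nat)" "8 - 2 = (6 :: nat)" "8 - 3 = (5 :: nat)" "8 - 4 = (4 :: nat)" "8 - 5 = (3 :: nat)" "8 - 6 = (2 :: nat)" "8 - 7 = (1 :: nat)"
  by simp_all

lemma decode_rotate:
  "set (decode [a, b, c, d, e, f, g, h, i, j, k, l, m, n]) =
    map_prod (cnext 7) (cnext 7) ` set (decode [c, d, e, f, g, h, i, j, k, l, m, n, a, b])"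
  by (simp only: decode_def all_flags_def set_decode_Cons set_decode_Nil image_Un
      image_guarded image_empty map_prod_simp cnext_values Un_ac)

lemma decode_reflect:
  "set (decode [a, b, c, d, e, f, g, h, i, j, k, l, m, n]) =
    map_prod (\<lambda>i. 8 - i) (\<lambda>i. 8 - i) ` set (decode [n, m, l, k, j, i, h, g, f, e, d, c, b, a])"
  by (simp only: decode_def all_flags_def set_decode_Cons set_decode_Nil image_Un
      image_guarded image_empty map_prod_simp reflection_values Un_ac)

lemma matches_included:
  "matches a b c d e f g h i j k l m n \<longleftrightarrow> (\<exists>p\<in>set patterns. included p [a, b, c, d, e, f, g, h, i, j, k, l, m, n])"
  by (simp add: matches_def patterns_def)

lemma matches_blocking:
  assumes "matches a b c d e f g h i j k l m n"
  shows "blocking (set (decode [a, b, c, d, e, f, g, h, i, j, k, l, m, n]))"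
proof -
  obtain p where p: "p \<in> set patterns" "included p [a, b, c, d, e, f, g, h, i, j, k, l, m, n]"
    using assms unfolding matches_included by blast
  moreover have "length p = 14"
    using p(1) by (auto simp: patterns_def)
  ultimately show ?thesis
    using blocking_mono[OF blocking_decode included_decode] by simp
qed

text \<open>A match found after a shift shows that a rotated set is blocking, and
  \<open>blocking_image\<close> rotates it back.\<close>

lemma rotation_matches_blocking:
  "rotation_matches r a b c d e f g h i j k l m n \<Longrightarrow> blocking (set (decode [a, b, c, d, e, f, g, h, i, j, k, l, m, n]))"
proof (induction r arbitrary: a b c d e f g h i j k l m n)
  case (Suc r)
  show ?case
  proof (cases "matches a b c d e f g h i j k l m n")
    case True
    then show ?thesis
      by (rule matches_blocking)
  next
    case False
    then show ?thesis
      unfolding decode_rotate[of a b c d e f g h i j k l m n]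
      using blocking_image[OF rotation_symmetry Suc.IH] Suc.prems by simp
  qed
qed simp

lemma dihedral_matches_blocking:
  assumes "dihedral_matches a b c d e f g h i j k l m n"
  shows "blocking (set (decode [a, b, c, d, e, f, g, h, i, j, k, l, m, n]))"
proof (cases "rotation_matches 7 a b c d e f g h i j k l m n")
  case True
  then show ?thesis
    by (rule rotation_matches_blocking)
next
  case False
  then have "rotation_matches 7 n m l k j i h g f e d c b a"
    using assms by (simp add: dihedral_matches_def)
  then show ?thesis
    unfolding decode_reflect[of a b c d e f g h i j k l m n]
    by (rule blocking_image[OF reflection_symmetry rotation_matches_blocking])
qed

lemma pattern_found_blocking:
  assumes "pattern_found fs"
  shows "blocking (set fs)"
proof (rule blocking_mono[OF dihedral_matches_blocking[OF assms[unfolded pattern_found_def]]])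
  show "set (decode [flag_in fs (1, 7), flag_in fs (1, 2), flag_in fs (2, 1), flag_in fs (2, 3), flag_in fs (3, 2),
    flag_in fs (3, 4), flag_in fs (4, 3), flag_in fs (4, 5), flag_in fs (5, 4), flag_in fs (5, 6),
    flag_in fs (6, 5), flag_in fs (6, 7), flag_in fs (7, 6), flag_in fs (7, 1)]) \<subseteq> set fs"
    by (simp only: decode_def all_flags_def set_decode_Cons set_decode_Nil flag_in_iff guarded_def) auto
qed

lemma walks_meet:
  assumes C: "walk 7 (replicate m 2) (eqbot 7) V"
    and F: "walk 7 (replicate a 2 @ 4 # replicate b 2) (eqbot 7) W"
  shows "V \<inter> W \<noteq> {}"
proof -
  have "m = 6"
    using walk_length[OF C repr_singletons] by (simp add: singletons_def sum_list_replicate)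
  \<comment> \<open>Of the six blocks lost between bottom and top, the 4-step accounts for three and
    each 2-step for one.\<close>
  have "a + b = 3"
    using walk_length[OF F repr_singletons] by (simp add: singletons_def sum_list_replicate)
  then consider "a = 0" "b = 3" | "a = 1" "b = 2" | "a = 2" "b = 1" | "a = 3" "b = 0"
    by linarith
  then have "collects pattern_found (replicate a 2 @ 4 # replicate b 2) [] singletons"
    by cases (use collects_4222 collects_2422 collects_2242 collects_2224 in \<open>simp_all add: numeral_eq_Suc\<close>)
  then obtain fs where "pattern_found fs" "set fs \<subseteq> W"
    using collects_walk[OF F repr_singletons] by fastforce
  then have "blocking W"
    using pattern_found_blocking blocking_mono by blast
  then show ?thesis
    using C \<open>m = 6\<close> unfolding blocking_def by blast
qed

theorem theorem1:
  shows "\<not> (\<exists>F. NCP_chain 7 F \<and>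
    (cond_I 7 F \<and> cond_II 7 F \<and> cond_III 7 F \<and> cond_IV 7 F) \<and>
    (cond_I 7 (dual 7 ` F) \<and> cond_II 7 (dual 7 ` F) \<and>
     cond_III 7 (dual 7 ` F) \<and> cond_IV 7 (dual 7 ` F)))"
proof
  assume "\<exists>F. NCP_chain 7 F \<and>
    (cond_I 7 F \<and> cond_II 7 F \<and> cond_III 7 F \<and> cond_IV 7 F) \<and>
    (cond_I 7 (dual 7 ` F) \<and> cond_II 7 (dual 7 ` F) \<and>
     cond_III 7 (dual 7 ` F) \<and> cond_IV 7 (dual 7 ` F))"
  then obtain F where F: "NCP_chain 7 F" "cond_III 7 F" "cond_IV 7 F"
    by blast
  obtain C where C: "NCP_maxchain 7 C"
    "\<forall>i\<in>{1..7}. min_block_nbrs 7 F i \<inter> min_block_nbrs 7 C i = {}"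
    using F(3) unfolding cond_IV_def by blast
  have chain: "NCP_chain 7 C"
    using C(1) by (simp add: NCP_maxchain_def NCP_chain_def pred_on.maxchain_def)
  obtain m V where V: "walk 7 (replicate m 2) (eqbot 7) V" "V \<subseteq> covered 7 (same ` C)"
    using NCP_chain_walk[OF chain] by blast
  obtain a b W where W: "walk 7 (replicate a 2 @ 4 # replicate b 2) (eqbot 7) W"
    "W \<subseteq> covered 7 (same ` F)"
    using cond_III_walk[OF F(1,2)] by blast
  obtain i j where ij: "(i, j) \<in> covered 7 (same ` C)" "(i, j) \<in> covered 7 (same ` F)"
    using walks_meet[OF V(1) W(1)] V(2) W(2) by auto
  have "j \<in> min_block_nbrs 7 F i \<inter> min_block_nbrs 7 C i"
    using covered_min_block[OF chain ij(1)] covered_min_block[OF F(1) ij(2)] ij(1)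
    by (auto simp: min_block_nbrs_def covered_def)
  moreover have "i \<in> {1..7}"
    using ij(1) by (simp add: covered_def)
  ultimately show False
    using C(2) by blast
qed

end
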